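(* For every positive integer $q$ and every vector $\mathbf a=(a_1,\dots,a_q)$ with $a_i>0$ ($i\in[q]$) and $\sum_{i=1}^q a_i=1$, the minimum $\mathbf a$-balanced $q$-way cut density $$f_q^{\mathbf a}(G)=\min_{(V_1,\dots,V_q)\in\mathcal P_q^{\mathbf a}}\frac1{\alpha_G^2}\sum_{i=1}^{q-1}\sum_{j=i+1}^q e_G(V_i,V_j)$$ is a testable weighted graph parameter.
   Context: $\mathcal G$ is the set of all finite weighted graphs $G$ on vertex sets $V(G)=[n]=\{1,\dots,n\}$ with vertex-weights $\alpha_i=\alpha_i(G)>0$ and edge-weights $\beta_{ij}=\beta_{ji}\in[0,1]$ ($i,j\in[n]$). Put $\alpha_G=\sum_i\alpha_i$, $\alpha_T=\sum_{i\in T}\alpha_i$ for $T\subset V(G)$, $\alpha_{\max}(G)=\max_i\alpha_i$, and $e_G(S,T)=\sum_{s\in S}\sum_{t\in T}\alpha_s\alpha_t\beta_{st}$. Simple graphs are regarded as elements of $\mathcal G$ with all vertex-weights $1$ and edge-weights $0$ or $1$ (no loops). $\mathcal P_q^{\mathbf a}$ is the set of partitions $(V_1,\dots,V_q)$ of $V(G)$ into $q$ non-empty disjoint sets such that $|\alpha_{V_i}/\alpha_G-a_i|\le\alpha_{\max}(G)/\alpha_G$ for $i=1,\dots,q$. Random sample: $\xi(k,G)$ is the random simple graph on vertex set $[k]$ obtained by choosing $k$ vertices $\Phi(1),\dots,\Phi(k)$ of $G$ independently, with replacement, each equal to $i$ with probability $\alpha_i/\alpha_G$, and then, given these, joining each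 pair $u\neq v$ in $[k]$ by an edge conditionally independently with probability $\beta_{\Phi(u)\Phi(v)}$. Testability: an isomorphism-invariant real-valued function $f$ of weighted graphs is testable if for every $\varepsilon>0$ there is a positive integer $k$ such that every $G\in\mathcal G$ with $\max_i\alpha_i(G)/\alpha_G\le1/k$ satisfies $\mathbb P(|f(G)-f(\xi(k,G))|>\varepsilon)\le\varepsilon$. If $f$ is given by a minimum over a set of partitions that may be empty for some graphs, $k$ is required to be such that $f$ is defined (that set is non-empty) for every $G\in\mathcal G$ with $\max_i\alpha_i(G)/\alpha_G\le1/k$; this includes every simple graph on $k$ vertices. *)

theory Defs
  imports "HOL-Probability.Probability" "HOL-Probability.Product_PMF"
begin

record wgraph =
  nverts :: nat
  vweight :: "nat \<Rightarrow> real"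
  eweight :: "nat \<Rightarrow> nat \<Rightarrow> real"

definition verts :: "wgraph \<Rightarrow> nat set" where
  "verts G = {1..nverts G}"

text \<open>Loops are allowed: the weight of a vertex paired with itself is any number in the unit
  interval. The values of both weight functions outside the vertex set are irrelevant.\<close>

definition wgraphs :: "wgraph set" where
  "wgraphs = {G. nverts G \<ge> 1 \<and>
     (\<forall>i\<in>verts G. vweight G i > 0) \<and>
     (\<forall>i\<in>verts G. \<forall>j\<in>verts G. eweight G i j \<in> {0..1} \<and> eweight G i j = eweight G j i)}"

definition weight_of :: "wgraph \<Rightarrow> nat set \<Rightarrow> real" where
  "weight_of G T = (\<Sum>i\<in>T. vweight G i)"

definition total_weight :: "wgraph \<Rightarrow> real" where
  "total_weight G = weight_of G (verts G)"

definition max_weight :: "wgraph \<Rightarrow> real" where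
  "max_weight G = Max (vweight G ` verts G)"

definition edges_between :: "wgraph \<Rightarrow> nat set \<Rightarrow> nat set \<Rightarrow> real" where
  "edges_between G S T = (\<Sum>s\<in>S. \<Sum>t\<in>T. vweight G s * vweight G t * eweight G s t)"

definition isomorphic :: "wgraph \<Rightarrow> wgraph \<Rightarrow> bool" where
  "isomorphic G H \<longleftrightarrow> (\<exists>\<pi>. bij_betw \<pi> (verts G) (verts H) \<and>
     (\<forall>i\<in>verts G. vweight H (\<pi> i) = vweight G i) \<and>
     (\<forall>i\<in>verts G. \<forall>j\<in>verts G. eweight H (\<pi> i) (\<pi> j) = eweight G i j))"

definition vertex_pmf :: "wgraph \<Rightarrow> nat pmf" where
  "vertex_pmf G = embed_pmf (\<lambda>i. if i \<in> verts G then vweight G i / total_weight G else 0)"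

lemma pmf_vertex_pmf:
  assumes "G \<in> wgraphs"
  shows "pmf (vertex_pmf G) i = (if i \<in> verts G then vweight G i / total_weight G else 0)"
proof -
  define p where "p = (\<lambda>i. if i \<in> verts G then vweight G i / total_weight G else 0)"
  have fin: "finite (verts G)" and ne: "verts G \<noteq> {}"
    using assms by (auto simp: verts_def wgraphs_def)
  have pos: "vweight G i > 0" if "i \<in> verts G" for i
    using assms that by (auto simp: wgraphs_def)
  then have tot: "total_weight G > 0"
    unfolding total_weight_def weight_of_def using fin ne by (intro sum_pos) auto
  have nonneg: "p i \<ge> 0" for i
    using pos[of i] tot by (auto simp: p_def)
  have "(\<integral>\<^sup>+i. ennreal (p i) \<partial>count_space UNIV) = (\<Sum>i\<in>verts G. ennreal (p i))"
    using fin by (intro nn_integral_count_space') (auto simp: p_def)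
  also have "\<dots> = ennreal (\<Sum>i\<in>verts G. p i)"
    using nonneg by (intro sum_ennreal) auto
  also have "(\<Sum>i\<in>verts G. p i) = 1"
    using tot by (simp add: p_def total_weight_def weight_of_def flip: sum_divide_distrib)
  finally have "(\<integral>\<^sup>+i. ennreal (p i) \<partial>count_space UNIV) = 1" by simp
  then show ?thesis
    using nonneg pmf_embed_pmf[of p i] by (simp add: vertex_pmf_def p_def)
qed

text \<open>\<open>X\<close> gives the adjacency of the pairs \<open>(u, v)\<close> with \<open>u < v\<close>. In \<open>sample\<close> it is
  \<open>False\<close> elsewhere, so that the sampled graph has no loops.\<close>

definition simple_graph :: "nat \<Rightarrow> (nat \<times> nat \<Rightarrow> bool) \<Rightarrow> wgraph" where
  "simple_graph k X =
     \<lparr>nverts = k, vweight = (\<lambda>_. 1), eweight = (\<lambda>u v. of_bool (X (min u v, max u v)))\<rparr>"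

definition sample :: "nat \<Rightarrow> wgraph \<Rightarrow> wgraph pmf" where
  "sample k G =
     bind_pmf (Pi_pmf {1..k} 0 (\<lambda>_. vertex_pmf G)) (\<lambda>\<Phi>.
       map_pmf (simple_graph k)
         (Pi_pmf {(u, v). 1 \<le> u \<and> u < v \<and> v \<le> k} False
           (\<lambda>(u, v). bernoulli_pmf (eweight G (\<Phi> u) (\<Phi> v)))))"

text \<open>Parameters may be partial (\<open>None\<close> means undefined). The index \<open>k\<close> must guarantee
  definedness on all graphs without dominant vertex weights, and hence on every sample of size
  \<open>k\<close>, whose relative vertex weights all equal \<open>1 / k\<close>; so \<open>the\<close> is only applied to defined
  values.\<close>

definition testable :: "(wgraph \<Rightarrow> real option) \<Rightarrow> bool" where
  "testable f \<longleftrightarrow>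
     (\<forall>G\<in>wgraphs. \<forall>H\<in>wgraphs. isomorphic G H \<longrightarrow> f G = f H) \<and>
     (\<forall>\<epsilon>>0. \<exists>k\<ge>1. \<forall>G\<in>wgraphs. max_weight G / total_weight G \<le> 1 / real k \<longrightarrow>
        f G \<noteq> None \<and>
        measure_pmf.prob (sample k G) {H. \<bar>the (f G) - the (f H)\<bar> > \<epsilon>} \<le> \<epsilon>)"

definition balanced_partitions ::
    "nat \<Rightarrow> (nat \<Rightarrow> real) \<Rightarrow> wgraph \<Rightarrow> (nat \<Rightarrow> nat set) set" where
  "balanced_partitions q a G =
     {V \<in> {1..q} \<rightarrow>\<^sub>E Pow (verts G).
        (\<Union>i\<in>{1..q}. V i) = verts G \<and> disjoint_family_on V {1..q} \<and>
        (\<forall>i\<in>{1..q}. V i \<noteq> {} \<and>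
           \<bar>weight_of G (V i) / total_weight G - a i\<bar> \<le> max_weight G / total_weight G)}"

definition cut_density :: "nat \<Rightarrow> wgraph \<Rightarrow> (nat \<Rightarrow> nat set) \<Rightarrow> real" where
  "cut_density q G V =
     1 / (total_weight G)\<^sup>2 * (\<Sum>i=1..q-1. \<Sum>j=i+1..q. edges_between G (V i) (V j))"

definition min_balanced_cut_density ::
    "nat \<Rightarrow> (nat \<Rightarrow> real) \<Rightarrow> wgraph \<Rightarrow> real option" where
  "min_balanced_cut_density q a G =
     (if balanced_partitions q a G = {} then None
      else Some (Min (cut_density q G ` balanced_partitions q a G)))"

end

theory Submission imports Defs begin

text \<open>Measure closeness of kernels by the density of four-cycles, which dominates the fourth power
  of every bilinear form with bounded weights (\<open>quad_bound\<close>) and whose expectation on a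
  sample is, up to \<open>6 / k\<close>, its value on the sampled graph. By an energy increment, any
  weighted graph is approximated in this sense by a step function of bounded complexity; Markov's
  inequality shows that the same step function, pulled back along the sampling map, approximates
  the sampled graph, and that the colour classes keep their proportions. Hence both graphs have
  nearly the same achievable pairs of class-by-part masses, and a balanced partition of one yields
  a balanced partition of the other with nearly the same cut density.\<close>

section \<open>Rebalancing partitions and the four-cycle bound\<close>

text \<open>The cut norm would be the usual measure of closeness, but bounding it on a random sample
  is delicate because it is a maximum over exponentially many sets. The four-cycle density is a
  polynomial in the kernel entries instead: its mean on a sample is computed term by term, and a
  first-moment bound suffices because a failure probability of \<open>\<epsilon>\<close> is allowed.
  The coin flips of the edges need no separate treatment, since the pairs of a four-cycle on
  distinct vertices are independent and have the right means. The price is a fourth root, which is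
  why the tolerances appear as \<open>\<kappa> ^ 4\<close>. Two further points shape the argument.
  The number of colours is bounded in terms of the regularity error alone, so every tolerance, and
  then \<open>k\<close>, is fixed before the graph is known. And the two graphs have different
  balance tolerances, \<open>max_weight G / total_weight G\<close> and \<open>1 / k\<close>; a
  transferred partition is therefore only nearly admissible and must be repaired by moving little
  weight, which changes the cut only slightly.\<close>

definition mass :: "'a set \<Rightarrow> ('a \<Rightarrow> real) \<Rightarrow> ('a \<Rightarrow> 'b) \<Rightarrow> 'b \<Rightarrow> real" where
  "mass S w f i = (\<Sum>v\<in>S. w v * of_bool (f v = i))"

text \<open>The strict inequality between labels counts each pair of parts once, as in a double sum
  over \<open>i < j\<close>.\<close>

definition qcut :: "'a set \<Rightarrow> ('a \<Rightarrow> real) \<Rightarrow> ('a \<Rightarrow> 'a \<Rightarrow> real) \<Rightarrow> ('a \<Rightarrow> nat) \<Rightarrow> real" where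
  "qcut S w K x = (\<Sum>s\<in>S. \<Sum>t\<in>S. w s * w t * (K s t * of_bool (x s < x t)))"

text \<open>The homomorphism density of the cycle \<open>s t s' t'\<close> in the kernel
  \<open>U\<close>.\<close>

definition quad :: "'a set \<Rightarrow> ('a \<Rightarrow> real) \<Rightarrow> ('a \<Rightarrow> 'a \<Rightarrow> real) \<Rightarrow> real" where
  "quad S w U = (\<Sum>s\<in>S. \<Sum>s'\<in>S. \<Sum>t\<in>S. \<Sum>t'\<in>S.
     w s * w s' * w t * w t' * (U s t * U s t' * U s' t * U s' t'))"

lemma mass_nonneg: "(\<And>v. v \<in> S \<Longrightarrow> 0 \<le> w v) \<Longrightarrow> 0 \<le> mass S w f i"
  unfolding mass_def by (intro sum_nonneg) auto

lemma mass_le_sum: "(\<And>v. v \<in> S \<Longrightarrow> 0 \<le> w v) \<Longrightarrow> mass S w f i \<le> sum w S"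
  unfolding mass_def by (intro sum_mono) auto

lemma sum_by_value:
  assumes "finite A" "f \<in> S \<rightarrow> A"
  shows "(\<Sum>s\<in>S. w s * g (f s)) = (\<Sum>a\<in>A. mass S w f a * g a)"
proof -
  have "(\<Sum>a\<in>A. mass S w f a * g a) = (\<Sum>s\<in>S. \<Sum>a\<in>A. w s * of_bool (f s = a) * g a)"
    unfolding mass_def sum_distrib_right by (rule sum.swap)
  also have "\<dots> = (\<Sum>s\<in>S. w s * g (f s))"
  proof (rule sum.cong[OF refl])
    fix s assume "s \<in> S"
    then have "f s \<in> A" using assms by auto
    have "(\<Sum>a\<in>A. w s * of_bool (f s = a) * g a) = (\<Sum>a\<in>A. if f s = a then w s * g a else 0)"
      by (intro sum.cong) auto
    then show "(\<Sum>a\<in>A. w s * of_bool (f s = a) * g a) = w s * g (f s)"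
      using \<open>f s \<in> A\<close> assms by simp
  qed
  finally show ?thesis by simp
qed

lemma sum_mass:
  assumes "finite A" "f \<in> S \<rightarrow> A"
  shows "(\<Sum>a\<in>A. mass S w f a) = sum w S"
  using sum_by_value[OF assms, of w "\<lambda>_. 1"] by simp

lemma sum_pair_by_value:
  assumes "finite A" "f \<in> S \<rightarrow> A"
  shows "(\<Sum>s\<in>S. \<Sum>t\<in>S. w s * w t * F (f s) (f t)) =
    (\<Sum>a\<in>A. \<Sum>b\<in>A. mass S w f a * mass S w f b * F a b)"
proof -
  have "(\<Sum>s\<in>S. \<Sum>t\<in>S. w s * w t * F (f s) (f t)) = (\<Sum>s\<in>S. w s * (\<Sum>t\<in>S. w t * F (f s) (f t)))"
    by (simp add: sum_distrib_left mult.assoc)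
  also have "\<dots> = (\<Sum>s\<in>S. w s * (\<Sum>b\<in>A. mass S w f b * F (f s) b))"
    using sum_by_value[OF assms, of w] by simp
  also have "\<dots> = (\<Sum>a\<in>A. mass S w f a * (\<Sum>b\<in>A. mass S w f b * F a b))"
    using sum_by_value[OF assms, of w "\<lambda>a. \<Sum>b\<in>A. mass S w f b * F a b"] by simp
  finally show ?thesis by (simp add: sum_distrib_left mult.assoc)
qed

lemma mass_fun_upd:
  assumes "finite S" "v \<in> S"
  shows "mass S w (y(v := j)) i = mass S w y i - w v * of_bool (y v = i) + w v * of_bool (j = i)"
proof -
  have "mass S w (y(v := j)) i = (\<Sum>u\<in>S. w u * of_bool (y u = i) +
      (if u = v then w v * of_bool (j = i) - w v * of_bool (y v = i) else 0))"
    unfolding mass_def by (intro sum.cong) auto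
  also have "\<dots> = mass S w y i + (w v * of_bool (j = i) - w v * of_bool (y v = i))"
    unfolding sum.distrib mass_def using assms by (subst sum.delta) auto
  finally show ?thesis by simp
qed

text \<open>Deviations within tolerance are priced at zero. With plain absolute values the partner
  part could lose as much as is gained; here it starts strictly on the other side of zero and moves
  by \<open>h \<le> \<eta>\<close>, so it cannot leave the tolerance on the far side, while the part
  out of tolerance improves by at least \<open>h\<close>.\<close>

lemma move_potential_aux:
  fixes e f h \<eta> :: real
  assumes "e > 0" "f < 0" "e > \<eta> \<or> f < - \<eta>" "0 < h" "h \<le> \<eta>"
  defines "\<phi> \<equiv> (\<lambda>t. if \<bar>t\<bar> > \<eta> then \<bar>t\<bar> else 0)"
  shows "\<phi> (e - h) + \<phi> (f + h) \<le> \<phi> e + \<phi> f - h"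
  using assms unfolding \<phi>_def by (auto simp: abs_if split: if_splits)

text \<open>Moving a vertex out of an overfull part, or into an underfull one, lowers the potential by
  at least the weight moved, because it never brings another part out of tolerance.\<close>

lemma rebalance:
  fixes S :: "'a set" and I :: "'b set"
  assumes S: "finite S" and I: "finite I"
    and w: "\<And>v. v \<in> S \<Longrightarrow> 0 < w v \<and> w v \<le> \<eta>"
    and x: "x \<in> S \<rightarrow> I" and b: "\<And>i. i \<in> I \<Longrightarrow> 0 \<le> b i" "sum b I = sum w S"
    and \<eta>: "0 \<le> \<eta>"
  shows "\<exists>y\<in>S \<rightarrow> I. (\<forall>i\<in>I. \<bar>mass S w y i - b i\<bar> \<le> \<eta>) \<and>
    (\<Sum>v\<in>S. w v * of_bool (x v \<noteq> y v)) \<le> (\<Sum>i\<in>I. \<bar>mass S w x i - b i\<bar>)"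
proof -
  define \<phi> where "\<phi> = (\<lambda>t::real. if \<bar>t\<bar> > \<eta> then \<bar>t\<bar> else 0)"
  define \<Phi> where "\<Phi> y = (\<Sum>i\<in>I. \<phi> (mass S w y i - b i))" for y
  define D where "D y = (\<Sum>v\<in>S. w v * of_bool (x v \<noteq> y v))" for y
  \<comment> \<open>The inequality is invariant under the moves: weight relabelled is paid for by
    potential lost. Minimising \<open>\<Phi>\<close> over this set, finite by extensionality,
    replaces an iteration of moves.\<close>
  define A where "A = {y \<in> S \<rightarrow>\<^sub>E I. D y + \<Phi> y \<le> \<Phi> x}"
  have "restrict x S \<in> A"
  proof -
    have "mass S w (restrict x S) = mass S w x"
      unfolding mass_def by (intro ext sum.cong) auto
    moreover have "D (restrict x S) = 0" unfolding D_def by (intro sum.neutral) auto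
    ultimately show ?thesis using x unfolding A_def \<Phi>_def by auto
  qed
  moreover have "finite A"
    unfolding A_def using finite_PiE[OF S, of "\<lambda>_. I"] I by simp
  ultimately obtain y where y: "y \<in> A" and ymin: "\<And>z. z \<in> A \<Longrightarrow> \<Phi> y \<le> \<Phi> z"
    using ex_min_if_finite[of "\<Phi> ` A"] by (metis (no_types, lifting) empty_iff finite_imageI imageE image_eqI not_le)
  have yI: "y \<in> S \<rightarrow> I" and yext: "y \<in> S \<rightarrow>\<^sub>E I" using y by (auto simp: A_def)
  have esum: "(\<Sum>i\<in>I. mass S w y i - b i) = 0"
    using sum_mass[OF I yI, of w] b(2) by (simp add: sum_subtractf)
  have bal: "\<bar>mass S w y i - b i\<bar> \<le> \<eta>" if "i \<in> I" for i
  proof (rule ccontr)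
    define e where "e i = mass S w y i - b i" for i
    assume "\<not> ?thesis"
    then have "e i > \<eta> \<or> e i < - \<eta>" by (auto simp: e_def)
    \<comment> \<open>The deviations sum to zero, so a part out of tolerance has a partner whose
      deviation has the opposite strict sign.\<close>
    then obtain i j where ij: "i \<in> I" "j \<in> I" "e i > 0" "e j < 0" "e i > \<eta> \<or> e j < - \<eta>"
    proof (elim disjE)
      assume *: "e i > \<eta>"
      have "\<exists>j\<in>I. e j < 0"
      proof (rule ccontr)
        assume "\<not> ?thesis"
        then have "\<forall>j\<in>I. e j = 0"
          using esum sum_nonneg_eq_0_iff[OF I, of e] by (force simp: e_def)
        then show False using * \<eta> that \<open>i \<in> I\<close> by force
      qed
      then show ?thesis using that * \<eta> \<open>i \<in> I\<close> by force
    next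
      assume *: "e i < - \<eta>"
      have "\<exists>j\<in>I. e j > 0"
      proof (rule ccontr)
        assume "\<not> ?thesis"
        moreover have "(\<Sum>i\<in>I. - e i) = 0" using esum by (simp add: e_def sum_subtractf)
        ultimately have "\<forall>j\<in>I. - e j = 0"
          using sum_nonneg_eq_0_iff[OF I, of "\<lambda>i. - e i"] by force
        then show False using * \<eta> that \<open>i \<in> I\<close> by force
      qed
      then show ?thesis using that * \<eta> \<open>i \<in> I\<close> by force
    qed
    \<comment> \<open>Since \<open>b i \<ge> 0\<close>, a part with positive deviation contains a
      vertex that can be moved.\<close>
    have "mass S w y i > 0" using ij(1,3) b(1)[of i] by (simp add: e_def)
    then obtain v where "v \<in> S" "w v * of_bool (y v = i) \<noteq> 0"
      unfolding mass_def by (force elim!: sum.not_neutral_contains_not_neutral[rotated])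
    then have v: "v \<in> S" "y v = i" by (auto split: if_splits)
    define z where "z = y(v := j)"
    have zP: "z \<in> S \<rightarrow>\<^sub>E I" using yext ij v by (auto simp: z_def PiE_def extensional_def)
    have "i \<noteq> j" using ij by auto
    have ez: "mass S w z l - b l = (if l = i then e i - w v else if l = j then e j + w v else e l)" for l
      unfolding z_def mass_fun_upd[OF S v(1)] using v(2) \<open>i \<noteq> j\<close> by (auto simp: e_def)
    have split: "(\<Sum>l\<in>I. g l) = g i + g j + (\<Sum>l\<in>I-{i,j}. g l)" for g :: "'b \<Rightarrow> real"
    proof -
      have "I = insert i (insert j (I - {i, j}))" using ij by auto
      then have "sum g I = sum g (insert i (insert j (I - {i, j})))" by simp
      then show ?thesis using \<open>i \<noteq> j\<close> I by simp
    qed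
    have "\<Phi> z = \<phi> (e i - w v) + \<phi> (e j + w v) + (\<Sum>l\<in>I-{i,j}. \<phi> (e l))"
      unfolding \<Phi>_def using \<open>i \<noteq> j\<close> by (subst split) (simp add: ez)
    moreover have "\<Phi> y = \<phi> (e i) + \<phi> (e j) + (\<Sum>l\<in>I-{i,j}. \<phi> (e l))"
      unfolding \<Phi>_def e_def by (rule split)
    moreover have "\<phi> (e i - w v) + \<phi> (e j + w v) \<le> \<phi> (e i) + \<phi> (e j) - w v"
      unfolding \<phi>_def using move_potential_aux[of "e i" "e j" \<eta> "w v"] ij w[OF v(1)] by blast
    ultimately have drop: "\<Phi> z \<le> \<Phi> y - w v" by linarith
    have "D z \<le> D y + w v"
    proof -
      have "D z \<le> (\<Sum>u\<in>S. w u * of_bool (x u \<noteq> y u) + (if u = v then w v else 0))"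
        unfolding D_def z_def using w[OF v(1)] by (intro sum_mono) auto
      also have "\<dots> = D y + w v" unfolding D_def sum.distrib using S v by simp
      finally show ?thesis .
    qed
    then have "z \<in> A" using zP drop y by (auto simp: A_def)
    from ymin[OF this] drop w[OF v(1)] show False by auto
  qed
  have "D y \<le> \<Phi> x"
  proof -
    have "0 \<le> \<Phi> y" unfolding \<Phi>_def \<phi>_def by (intro sum_nonneg) auto
    then show ?thesis using y by (auto simp: A_def)
  qed
  also have "\<dots> \<le> (\<Sum>i\<in>I. \<bar>mass S w x i - b i\<bar>)"
    unfolding \<Phi>_def \<phi>_def by (intro sum_mono) auto
  finally show ?thesis using yI bal unfolding D_def by blast
qed

section \<open>Jensen's inequality and four-cycle densities\<close>

lemma jensen_square:
  assumes w: "\<And>v. v \<in> S \<Longrightarrow> 0 \<le> w v" "sum w S = (1::real)"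
  shows "(\<Sum>v\<in>S. w v * f v)\<^sup>2 \<le> (\<Sum>v\<in>S. w v * (f v)\<^sup>2)"
proof -
  define m where "m = (\<Sum>v\<in>S. w v * f v)"
  \<comment> \<open>This is the variance of \<open>f\<close> under the probability weights
    \<open>w\<close>.\<close>
  have "0 \<le> (\<Sum>v\<in>S. w v * (f v - m)\<^sup>2)" using w by (intro sum_nonneg) auto
  also have "\<dots> = (\<Sum>v\<in>S. w v * (f v)\<^sup>2 - 2 * m * (w v * f v) + m\<^sup>2 * w v)"
    by (intro sum.cong) (auto simp: power2_eq_square algebra_simps)
  also have "\<dots> = (\<Sum>v\<in>S. w v * (f v)\<^sup>2) - m\<^sup>2"
    using w(2) by (simp add: sum.distrib sum_subtractf flip: sum_distrib_left m_def)
      (simp add: power2_eq_square)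
  finally show ?thesis by (simp add: m_def)
qed

lemma jensen_square_pair:
  assumes w: "\<And>v. v \<in> S \<Longrightarrow> 0 \<le> w v" "sum w S = (1::real)"
  shows "(\<Sum>s\<in>S. \<Sum>t\<in>S. w s * w t * f s t)\<^sup>2 \<le> (\<Sum>s\<in>S. \<Sum>t\<in>S. w s * w t * (f s t)\<^sup>2)"
proof -
  have "(\<Sum>s\<in>S. w s * (\<Sum>t\<in>S. w t * f s t))\<^sup>2 \<le> (\<Sum>s\<in>S. w s * (\<Sum>t\<in>S. w t * f s t)\<^sup>2)"
    by (rule jensen_square[OF w])
  also have "\<dots> \<le> (\<Sum>s\<in>S. w s * (\<Sum>t\<in>S. w t * (f s t)\<^sup>2))"
    using w by (intro sum_mono mult_left_mono jensen_square) auto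
  finally show ?thesis by (simp add: sum_distrib_left mult.assoc)
qed

text \<open>For fixed \<open>t\<close> and \<open>t'\<close> the cycle splits into two independent
  paths, through \<open>s\<close> and through \<open>s'\<close>, so the density is an average of
  squared codegrees. This shows nonnegativity and is the form in which \<open>quad_bound\<close>
  ends.\<close>

lemma quad_eq:
  "quad S w U = (\<Sum>t\<in>S. \<Sum>t'\<in>S. w t * w t' * (\<Sum>s\<in>S. w s * (U s t * U s t'))\<^sup>2)"
proof -
  have "(\<Sum>t\<in>S. \<Sum>t'\<in>S. w t * w t' * (\<Sum>s\<in>S. w s * (U s t * U s t'))\<^sup>2) =
     (\<Sum>t\<in>S. \<Sum>t'\<in>S. \<Sum>s\<in>S. \<Sum>s'\<in>S. w s * w s' * w t * w t' * (U s t * U s t' * U s' t * U s' t'))"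
    by (simp add: power2_eq_square sum_product sum_distrib_left mult_ac)
  also have "\<dots> = (\<Sum>t\<in>S. \<Sum>s\<in>S. \<Sum>t'\<in>S. \<Sum>s'\<in>S. w s * w s' * w t * w t' * (U s t * U s t' * U s' t * U s' t'))"
    by (intro sum.cong refl sum.swap)
  also have "\<dots> = (\<Sum>s\<in>S. \<Sum>t\<in>S. \<Sum>t'\<in>S. \<Sum>s'\<in>S. w s * w s' * w t * w t' * (U s t * U s t' * U s' t * U s' t'))"
    by (rule sum.swap)
  also have "\<dots> = (\<Sum>s\<in>S. \<Sum>t\<in>S. \<Sum>s'\<in>S. \<Sum>t'\<in>S. w s * w s' * w t * w t' * (U s t * U s t' * U s' t * U s' t'))"
    by (intro sum.cong refl sum.swap)
  also have "\<dots> = quad S w U"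
    unfolding quad_def by (intro sum.cong refl sum.swap)
  finally show ?thesis by simp
qed

lemma quad_nonneg: "(\<And>v. v \<in> S \<Longrightarrow> 0 \<le> w v) \<Longrightarrow> 0 \<le> quad S w U"
  unfolding quad_eq by (intro sum_nonneg mult_nonneg_nonneg) auto

text \<open>Cauchy-Schwarz twice. Squaring the average over \<open>s\<close> eliminates
  \<open>g\<close> and doubles \<open>t\<close>; squaring the resulting average over
  \<open>t\<close> and \<open>t'\<close> eliminates \<open>h\<close> and leaves squared
  codegrees.\<close>

lemma quad_bound:
  assumes w: "\<And>v. v \<in> S \<Longrightarrow> 0 \<le> w v" "sum w S = (1::real)"
    and g: "\<And>v. v \<in> S \<Longrightarrow> \<bar>g v\<bar> \<le> 1" and h: "\<And>v. v \<in> S \<Longrightarrow> \<bar>h v\<bar> \<le> 1"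
  shows "(\<Sum>s\<in>S. \<Sum>t\<in>S. w s * w t * (U s t * (g s * h t))) ^ 4 \<le> quad S w U"
proof -
  define F where "F s = (\<Sum>t\<in>S. w t * (U s t * h t))" for s
  have sq: "r\<^sup>2 \<le> 1" if "\<bar>r\<bar> \<le> 1" for r :: real
    using that by (simp add: abs_square_le_1)
  have "(\<Sum>s\<in>S. \<Sum>t\<in>S. w s * w t * (U s t * (g s * h t))) = (\<Sum>s\<in>S. w s * (g s * F s))"
    unfolding F_def by (simp add: sum_distrib_left mult_ac)
  then have "(\<Sum>s\<in>S. \<Sum>t\<in>S. w s * w t * (U s t * (g s * h t)))\<^sup>2 \<le> (\<Sum>s\<in>S. w s * (g s * F s)\<^sup>2)"
    using jensen_square[OF w] by simp
  also have "\<dots> \<le> (\<Sum>s\<in>S. w s * (F s)\<^sup>2)"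
    using w g sq by (intro sum_mono mult_left_mono) (auto simp: power_mult_distrib intro!: mult_left_le_one_le)
  also have "\<dots> = (\<Sum>s\<in>S. \<Sum>t\<in>S. \<Sum>t'\<in>S. w s * (w t * (U s t * h t) * (w t' * (U s t' * h t'))))"
    unfolding F_def power2_eq_square sum_product by (simp add: sum_distrib_left)
  also have "\<dots> = (\<Sum>t\<in>S. \<Sum>s\<in>S. \<Sum>t'\<in>S. w s * (w t * (U s t * h t) * (w t' * (U s t' * h t'))))"
    by (rule sum.swap)
  also have "\<dots> = (\<Sum>t\<in>S. \<Sum>t'\<in>S. \<Sum>s\<in>S. w s * (w t * (U s t * h t) * (w t' * (U s t' * h t'))))"
    by (intro sum.cong refl sum.swap)
  also have "\<dots> = (\<Sum>t\<in>S. \<Sum>t'\<in>S. w t * w t' * (h t * h t' * (\<Sum>s\<in>S. w s * (U s t * U s t'))))"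
    by (simp add: sum_distrib_left mult_ac)
  finally have 1: "(\<Sum>s\<in>S. \<Sum>t\<in>S. w s * w t * (U s t * (g s * h t)))\<^sup>2
    \<le> (\<Sum>t\<in>S. \<Sum>t'\<in>S. w t * w t' * (h t * h t' * (\<Sum>s\<in>S. w s * (U s t * U s t'))))" .
  have "(\<Sum>s\<in>S. \<Sum>t\<in>S. w s * w t * (U s t * (g s * h t))) ^ 4
     = ((\<Sum>s\<in>S. \<Sum>t\<in>S. w s * w t * (U s t * (g s * h t)))\<^sup>2)\<^sup>2"
    by simp
  also have "\<dots> \<le> (\<Sum>t\<in>S. \<Sum>t'\<in>S. w t * w t' * (h t * h t' * (\<Sum>s\<in>S. w s * (U s t * U s t'))))\<^sup>2"
    using 1 by (intro power_mono) auto
  also have "\<dots> \<le> (\<Sum>t\<in>S. \<Sum>t'\<in>S. w t * w t' * (h t * h t' * (\<Sum>s\<in>S. w s * (U s t * U s t')))\<^sup>2)"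
    by (rule jensen_square_pair[OF w])
  also have "\<dots> \<le> (\<Sum>t\<in>S. \<Sum>t'\<in>S. w t * w t' * (\<Sum>s\<in>S. w s * (U s t * U s t'))\<^sup>2)"
  proof (intro sum_mono mult_left_mono)
    fix t t' assume t: "t \<in> S" "t' \<in> S"
    have "\<bar>h t * h t'\<bar> \<le> 1" using h[OF t(1)] h[OF t(2)] by (auto simp: abs_mult intro: mult_le_one)
    then show "(h t * h t' * (\<Sum>s\<in>S. w s * (U s t * U s t')))\<^sup>2 \<le> (\<Sum>s\<in>S. w s * (U s t * U s t'))\<^sup>2"
      using sq by (auto simp: power_mult_distrib[of "h t * h t'"] intro!: mult_left_le_one_le)
    show "0 \<le> w t * w t'" using w t by auto
  qed
  finally show ?thesis unfolding quad_eq .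
qed

section \<open>Weak regularity\<close>

lemma weighted_sum_pair_greater:
  fixes f :: "'a \<Rightarrow> 'a \<Rightarrow> real"
  assumes "c < (\<Sum>s\<in>S. \<Sum>t\<in>S. w s * w t * f s t)"
    and w: "\<And>v. v \<in> S \<Longrightarrow> 0 \<le> w v" "sum w S = (1::real)"
  shows "\<exists>s\<in>S. \<exists>t\<in>S. c < f s t"
proof (rule ccontr)
  assume "\<not> ?thesis"
  then have le: "f s t \<le> c" if "s \<in> S" "t \<in> S" for s t using that by force
  have "(\<Sum>s\<in>S. \<Sum>t\<in>S. w s * w t * f s t) \<le> (\<Sum>s\<in>S. \<Sum>t\<in>S. w s * w t * c)"
    using w le by (intro sum_mono mult_left_mono) auto
  also have "\<dots> = c" using w(2) by (simp flip: sum_distrib_left sum_distrib_right)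
  finally show False using assms(1) by simp
qed

text \<open>Rounding down to the grid of mesh \<open>1 / L\<close>. The integer index is kept so
  that colours come from a finite set depending on \<open>L\<close> only.\<close>

definition level :: "nat \<Rightarrow> real \<Rightarrow> int" where
  "level L r = \<lfloor>r * real L\<rfloor>"

lemma level_props:
  assumes "L \<ge> 1" "\<bar>r\<bar> \<le> 1"
  shows "level L r \<in> {- int L..int L}" "\<bar>real_of_int (level L r) / real L\<bar> \<le> 1"
    "\<bar>r - real_of_int (level L r) / real L\<bar> \<le> 1 / real L"
proof -
  have L: "real L > 0" using assms by simp
  have "\<bar>r * real L\<bar> \<le> real L" using assms by (simp add: abs_mult mult_left_le_one_le)
  then have *: "- real L \<le> r * real L" "r * real L \<le> real L" by linarith+
  have "- int L \<le> level L r" unfolding level_def using *(1) by (subst le_floor_iff) simp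
  moreover have "level L r \<le> int L"
    unfolding level_def using *(2) by (metis floor_mono floor_of_nat)
  ultimately show 1: "level L r \<in> {- int L..int L}" by simp
  then have "real_of_int (- int L) \<le> real_of_int (level L r)" "real_of_int (level L r) \<le> real_of_int (int L)"
    unfolding of_int_le_iff by auto
  then show "\<bar>real_of_int (level L r) / real L\<bar> \<le> 1"
    using L by (simp add: abs_le_iff field_simps)
  have "\<bar>r * real L - real_of_int (level L r)\<bar> \<le> 1"
    unfolding level_def by linarith
  moreover have "r - real_of_int (level L r) / real L = (r * real L - real_of_int (level L r)) / real L"
    using L by (simp add: field_simps)
  ultimately show "\<bar>r - real_of_int (level L r) / real L\<bar> \<le> 1 / real L"
    using L by (simp add: divide_right_mono)
qed

lemma prod_diff_le:
  fixes a b c d :: real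
  assumes "\<bar>a - c\<bar> \<le> \<theta>" "\<bar>b - d\<bar> \<le> \<theta>" "\<bar>b\<bar> \<le> 1" "\<bar>c\<bar> \<le> 1"
  shows "\<bar>a * b - c * d\<bar> \<le> 2 * \<theta>"
proof -
  have "a * b - c * d = (a - c) * b + c * (b - d)" by (simp add: algebra_simps)
  moreover have "\<bar>(a - c) * b\<bar> \<le> \<theta> * 1"
    unfolding abs_mult using assms by (intro mult_mono) linarith+
  moreover have "\<bar>c * (b - d)\<bar> \<le> 1 * \<theta>"
    unfolding abs_mult using assms by (intro mult_mono) linarith+
  ultimately show ?thesis by linarith
qed

definition clamp01 :: "real \<Rightarrow> real" where
  "clamp01 r = max 0 (min 1 r)"

text \<open>Clamping is the nearest-point projection onto the unit interval, so it never increases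
  the distance to a point of that interval.\<close>

lemma clamp01_contract: "0 \<le> a \<Longrightarrow> a \<le> 1 \<Longrightarrow> (a - clamp01 r)\<^sup>2 \<le> (a - r)\<^sup>2"
  unfolding clamp01_def abs_le_square_iff[symmetric] by (auto simp: abs_if max_def min_def)

lemma abs_weighted_sum_pair_le:
  assumes w: "\<And>v. v \<in> S \<Longrightarrow> 0 \<le> w v" "sum w S = (1::real)"
    and "\<And>s t. s \<in> S \<Longrightarrow> t \<in> S \<Longrightarrow> \<bar>f s t\<bar> \<le> c"
  shows "\<bar>\<Sum>s\<in>S. \<Sum>t\<in>S. w s * w t * f s t\<bar> \<le> c"
proof -
  have "\<bar>\<Sum>s\<in>S. \<Sum>t\<in>S. w s * w t * f s t\<bar> \<le> (\<Sum>s\<in>S. \<Sum>t\<in>S. \<bar>w s * w t * f s t\<bar>)"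
    by (rule order_trans[OF sum_abs sum_mono[OF sum_abs]])
  also have "\<dots> \<le> (\<Sum>s\<in>S. \<Sum>t\<in>S. w s * w t * c)"
    using w assms(3) by (intro sum_mono) (auto simp: abs_mult intro!: mult_left_mono)
  also have "\<dots> = c" using w(2) by (simp flip: sum_distrib_left sum_distrib_right)
  finally show ?thesis .
qed

text \<open>Two levels per vertex, because it occurs both as a row and as a column of the kernel and
  the correlated function \<open>g s * h t\<close> need not be symmetric. The first level is read
  for rows, the second for columns.\<close>

definition step_colors :: "nat \<Rightarrow> (int \<times> int) set" where
  "step_colors L = {- int L..int L} \<times> {- int L..int L}"

text \<open>A large four-cycle density of the error singles out a correlated rank-one function, and
  subtracting a small multiple of its discretisation lowers the squared error. Clamping keeps the
  step function in the unit interval without increasing the error.\<close>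

lemma regularity_step:
  fixes K :: "'a \<Rightarrow> 'a \<Rightarrow> real" and d :: "(int \<times> int) list \<Rightarrow> (int \<times> int) list \<Rightarrow> real"
  assumes w: "\<And>v. v \<in> S \<Longrightarrow> 0 \<le> w v" "sum w S = 1"
    and K: "\<And>s t. s \<in> S \<Longrightarrow> t \<in> S \<Longrightarrow> K s t \<in> {0..1}"
    and d: "\<And>p p'. d p p' \<in> {0..1}"
    and \<delta>: "0 < \<delta>" and L: "4 / \<delta> \<le> real L"
    and large: "\<delta> < quad S w (\<lambda>s t. K s t - d (c s) (c t))"
  obtains l d' where "\<And>v. v \<in> S \<Longrightarrow> l v \<in> step_colors L" "\<And>p p'. d' p p' \<in> {0..(1::real)}"
    "(\<Sum>s\<in>S. \<Sum>t\<in>S. w s * w t * (K s t - d' (l s # c s) (l t # c t))\<^sup>2)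
      \<le> (\<Sum>s\<in>S. \<Sum>t\<in>S. w s * w t * (K s t - d (c s) (c t))\<^sup>2) - \<delta>\<^sup>2 / 4"
proof -
  define U where "U s t = K s t - d (c s) (c t)" for s t
  have U1: "\<bar>U s t\<bar> \<le> 1" if "s \<in> S" "t \<in> S" for s t
    using K[OF that] d[of "c s" "c t"] by (auto simp: U_def abs_le_iff)
  have L0: "0 < real L" using \<delta> L by (meson divide_pos_pos less_le_trans zero_less_numeral)
  then have L1: "L \<ge> 1" by simp
  \<comment> \<open>With \<open>s'\<close> and \<open>t'\<close> outermost, some fixed pair does at
    least as well as the average. Three of the four factors then depend on \<open>s\<close> alone or
    on \<open>t\<close> alone, which exhibits a rank-one function correlated with
    \<open>U\<close>.\<close>
  have "quad S w U = (\<Sum>s'\<in>S. \<Sum>s\<in>S. \<Sum>t\<in>S. \<Sum>t'\<in>S.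
     w s * w s' * w t * w t' * (U s t * U s t' * U s' t * U s' t'))"
    unfolding quad_def by (rule sum.swap)
  also have "\<dots> = (\<Sum>s'\<in>S. \<Sum>s\<in>S. \<Sum>t'\<in>S. \<Sum>t\<in>S.
     w s * w s' * w t * w t' * (U s t * U s t' * U s' t * U s' t'))"
    by (intro sum.cong refl sum.swap)
  also have "\<dots> = (\<Sum>s'\<in>S. \<Sum>t'\<in>S. \<Sum>s\<in>S. \<Sum>t\<in>S.
     w s * w s' * w t * w t' * (U s t * U s t' * U s' t * U s' t'))"
    by (intro sum.cong refl sum.swap)
  also have "\<dots> = (\<Sum>s'\<in>S. \<Sum>t'\<in>S. w s' * w t' *
      (\<Sum>s\<in>S. \<Sum>t\<in>S. w s * w t * (U s t * ((U s' t' * U s t') * U s' t))))"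
    by (simp add: sum_distrib_left mult_ac)
  finally have "\<delta> < (\<Sum>s'\<in>S. \<Sum>t'\<in>S. w s' * w t' *
      (\<Sum>s\<in>S. \<Sum>t\<in>S. w s * w t * (U s t * ((U s' t' * U s t') * U s' t))))"
    using large unfolding U_def by simp
  from weighted_sum_pair_greater[OF this w]
  obtain s' t' where st': "s' \<in> S" "t' \<in> S"
    and corr: "\<delta> < (\<Sum>s\<in>S. \<Sum>t\<in>S. w s * w t * (U s t * ((U s' t' * U s t') * U s' t)))"
    by blast
  define g where "g s = U s' t' * U s t'" for s
  define h where "h t = U s' t" for t
  have g1: "\<bar>g s\<bar> \<le> 1" if "s \<in> S" for s
    using U1[OF st'] U1[OF that st'(2)] by (auto simp: g_def abs_mult intro: mult_le_one)
  have h1: "\<bar>h s\<bar> \<le> 1" if "s \<in> S" for s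
    using U1[OF st'(1) that] by (auto simp: h_def)
  define l where "l v = (level L (g v), level L (h v))" for v
  define G where "G = (\<lambda>v. real_of_int (fst (l v)) / real L)"
  define H where "H = (\<lambda>v. real_of_int (snd (l v)) / real L)"
  \<comment> \<open>Rounding costs at most \<open>2 / L \<le> \<delta> / 2\<close> of the
    correlation \<open>\<delta>\<close>, so at least \<open>\<tau>\<close> survives. Subtracting
    \<open>\<tau>\<close> times the rounded function changes the squared error by at most
    \<open>- 2 * \<tau>\<^sup>2 + \<tau>\<^sup>2\<close>, which is the claimed drop of
    \<open>\<delta>\<^sup>2 / 4\<close>.\<close>
  define \<tau> where "\<tau> = \<delta> / 2"
  define d' where "d' p p' = clamp01 (d (tl p) (tl p') +
     \<tau> * (real_of_int (fst (hd p)) / real L * (real_of_int (snd (hd p')) / real L)))" for p p'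
  have G: "\<bar>G v\<bar> \<le> 1" "\<bar>g v - G v\<bar> \<le> 1 / real L" if "v \<in> S" for v
    using level_props[OF L1 g1[OF that]] by (auto simp: G_def l_def)
  have H: "\<bar>H v\<bar> \<le> 1" "\<bar>h v - H v\<bar> \<le> 1 / real L" if "v \<in> S" for v
    using level_props[OF L1 h1[OF that]] by (auto simp: H_def l_def)
  have "\<bar>\<Sum>s\<in>S. \<Sum>t\<in>S. w s * w t * (U s t * (g s * h t - G s * H t))\<bar> \<le> 2 * (1 / real L)"
  proof (rule abs_weighted_sum_pair_le[OF w])
    fix s t assume "s \<in> S" "t \<in> S"
    then have "\<bar>g s * h t - G s * H t\<bar> \<le> 2 * (1 / real L)"
      using G H h1 by (intro prod_diff_le) auto
    then have "\<bar>U s t\<bar> * \<bar>g s * h t - G s * H t\<bar> \<le> 1 * (2 * (1 / real L))"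
      using U1 \<open>s \<in> S\<close> \<open>t \<in> S\<close> by (intro mult_mono) auto
    then show "\<bar>U s t * (g s * h t - G s * H t)\<bar> \<le> 2 * (1 / real L)"
      by (simp add: abs_mult)
  qed
  also have "2 * (1 / real L) \<le> \<tau>"
    using L L0 \<delta> by (simp add: \<tau>_def field_simps)
  finally have "(\<Sum>s\<in>S. \<Sum>t\<in>S. w s * w t * (U s t * (g s * h t - G s * H t))) \<le> \<tau>"
    by linarith
  then have "(\<Sum>s\<in>S. \<Sum>t\<in>S. w s * w t * (U s t * (g s * h t)))
     - (\<Sum>s\<in>S. \<Sum>t\<in>S. w s * w t * (U s t * (G s * H t))) \<le> \<tau>"
    by (simp add: right_diff_distrib sum_subtractf)
  then have corr': "\<tau> \<le> (\<Sum>s\<in>S. \<Sum>t\<in>S. w s * w t * (U s t * (G s * H t)))"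
    using corr by (simp add: g_def h_def \<tau>_def)
  have "(\<Sum>s\<in>S. \<Sum>t\<in>S. w s * w t * (K s t - d' (l s # c s) (l t # c t))\<^sup>2)
      \<le> (\<Sum>s\<in>S. \<Sum>t\<in>S. w s * w t * (U s t - \<tau> * (G s * H t))\<^sup>2)"
  proof (intro sum_mono mult_left_mono)
    fix s t assume st: "s \<in> S" "t \<in> S"
    have "(K s t - d' (l s # c s) (l t # c t))\<^sup>2 \<le> (K s t - (d (c s) (c t) + \<tau> * (G s * H t)))\<^sup>2"
      unfolding d'_def G_def H_def list.sel using K[OF st] by (intro clamp01_contract) auto
    then show "(K s t - d' (l s # c s) (l t # c t))\<^sup>2 \<le> (U s t - \<tau> * (G s * H t))\<^sup>2"
      by (simp add: U_def algebra_simps)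
    show "0 \<le> w s * w t" using w st by auto
  qed
  also have "\<dots> = (\<Sum>s\<in>S. \<Sum>t\<in>S. w s * w t * (U s t)\<^sup>2)
     - 2 * \<tau> * (\<Sum>s\<in>S. \<Sum>t\<in>S. w s * w t * (U s t * (G s * H t)))
     + \<tau>\<^sup>2 * (\<Sum>s\<in>S. \<Sum>t\<in>S. w s * w t * (G s * H t)\<^sup>2)"
  proof -
    have "w s * w t * (U s t - \<tau> * (G s * H t))\<^sup>2 = w s * w t * (U s t)\<^sup>2
        - 2 * \<tau> * (w s * w t * (U s t * (G s * H t))) + \<tau>\<^sup>2 * (w s * w t * (G s * H t)\<^sup>2)" for s t
      by (simp add: power2_eq_square algebra_simps)
    then show ?thesis by (simp add: sum.distrib sum_subtractf sum_distrib_left)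
  qed
  also have "\<dots> \<le> (\<Sum>s\<in>S. \<Sum>t\<in>S. w s * w t * (U s t)\<^sup>2) - 2 * \<tau> * \<tau> + \<tau>\<^sup>2 * 1"
  proof -
    have "\<bar>\<Sum>s\<in>S. \<Sum>t\<in>S. w s * w t * (G s * H t)\<^sup>2\<bar> \<le> 1"
    proof (rule abs_weighted_sum_pair_le[OF w])
      fix s t assume st: "s \<in> S" "t \<in> S"
      then have "\<bar>G s * H t\<bar> \<le> 1" using G H by (auto simp: abs_mult intro: mult_le_one)
      then show "\<bar>(G s * H t)\<^sup>2\<bar> \<le> 1" by (simp add: abs_square_le_1)
    qed
    then have "\<tau>\<^sup>2 * (\<Sum>s\<in>S. \<Sum>t\<in>S. w s * w t * (G s * H t)\<^sup>2) \<le> \<tau>\<^sup>2 * 1"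
      by (intro mult_left_mono) auto
    moreover have "2 * \<tau> * \<tau> \<le> 2 * \<tau> * (\<Sum>s\<in>S. \<Sum>t\<in>S. w s * w t * (U s t * (G s * H t)))"
      using corr' \<delta> by (intro mult_left_mono) (auto simp: \<tau>_def)
    ultimately show ?thesis by linarith
  qed
  also have "\<dots> = (\<Sum>s\<in>S. \<Sum>t\<in>S. w s * w t * (U s t)\<^sup>2) - \<delta>\<^sup>2 / 4"
    by (simp add: \<tau>_def power2_eq_square)
  finally show ?thesis
  proof (intro that[of l d'])
    show "l v \<in> step_colors L" if "v \<in> S" for v
      using level_props(1)[OF L1 g1[OF that]] level_props(1)[OF L1 h1[OF that]]
      by (auto simp: l_def step_colors_def)
    show "d' p p' \<in> {0..1}" for p p' by (auto simp: d'_def clamp01_def)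
  qed (simp add: U_def)
qed

text \<open>A colour records one pair of levels for each refinement step, most recent first.\<close>

definition colors :: "real \<Rightarrow> (int \<times> int) list set" where
  "colors \<delta> = {xs. set xs \<subseteq> step_colors (nat \<lceil>4 / \<delta>\<rceil>) \<and> length xs \<le> nat \<lceil>4 / \<delta>\<^sup>2\<rceil>}"

lemma finite_colors: "finite (colors \<delta>)"
  unfolding colors_def by (rule finite_lists_length_le) (simp add: step_colors_def)

text \<open>Energy increment: the squared error starts at no more than 1 and each refinement lowers
  it by \<open>\<delta>\<^sup>2 / 4\<close>. What matters later is that
  \<open>colors \<delta>\<close> does not depend on the graph, and that \<open>d\<close> is a
  function of colours alone, so that it also defines a kernel on any other coloured vertex
  set.\<close>

lemma weak_regularity:
  fixes K :: "'a \<Rightarrow> 'a \<Rightarrow> real"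
  assumes w: "\<And>v. v \<in> S \<Longrightarrow> 0 \<le> w v" "sum w S = 1"
    and K: "\<And>s t. s \<in> S \<Longrightarrow> t \<in> S \<Longrightarrow> K s t \<in> {0..1}"
    and \<delta>: "0 < \<delta>"
  obtains c d where "c \<in> S \<rightarrow> colors \<delta>" "\<And>p p'. d p p' \<in> {0..(1::real)}"
    "quad S w (\<lambda>s t. K s t - d (c s) (c t)) \<le> \<delta>"
proof -
  define err where "err c d = (\<Sum>s\<in>S. \<Sum>t\<in>S. w s * w t * (K s t - d (c s) (c t))\<^sup>2)"
    for c :: "'a \<Rightarrow> (int \<times> int) list" and d :: "_ \<Rightarrow> _ \<Rightarrow> real"
  define L where "L = nat \<lceil>4 / \<delta>\<rceil>"
  define N where "N = nat \<lceil>4 / \<delta>\<^sup>2\<rceil>"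
  have L: "4 / \<delta> \<le> real L" unfolding L_def by (rule real_nat_ceiling_ge)
  define good where "good c d \<longleftrightarrow> c \<in> S \<rightarrow> colors \<delta> \<and> (\<forall>p p'. d p p' \<in> {0..1}) \<and>
     quad S w (\<lambda>s t. K s t - d (c s) (c t)) \<le> \<delta>" for c and d :: "_ \<Rightarrow> _ \<Rightarrow> real"
  \<comment> \<open>The range goes one beyond \<open>N\<close>. Refinement starts only from colours
    of length \<open>n \<le> N\<close>, which lie in \<open>colors \<delta>\<close>; the longer ones
    reached at \<open>Suc N\<close> serve only for the contradiction with a nonnegative
    error.\<close>
  have step: "(\<exists>c d. good c d) \<or> (\<exists>c d. (\<forall>v\<in>S. set (c v) \<subseteq> step_colors L \<and> length (c v) = n) \<and>
     (\<forall>p p'. d p p' \<in> {0..1}) \<and> err c d \<le> 1 - real n * (\<delta>\<^sup>2 / 4))" if "n \<le> Suc N" for n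
    using that
  proof (induction n)
    case 0
    have "err (\<lambda>_. []) (\<lambda>_ _. 0) \<le> 1"
      unfolding err_def
    proof (rule order_trans[OF abs_ge_self abs_weighted_sum_pair_le[OF w]])
      fix s t assume "s \<in> S" "t \<in> S"
      then show "\<bar>(K s t - 0)\<^sup>2\<bar> \<le> 1" using K[of s t] by (simp add: abs_square_le_1 abs_le_iff)
    qed
    then show ?case by (intro disjI2 exI[of _ "\<lambda>_. []"] exI[of _ "\<lambda>_ _. 0"]) auto
  next
    case (Suc n)
    show ?case
    proof (cases "\<exists>c d. good c d")
      case False
      then have "\<exists>c d. (\<forall>v\<in>S. set (c v) \<subseteq> step_colors L \<and> length (c v) = n) \<and>
          (\<forall>p p'. d p p' \<in> {0..1}) \<and> err c d \<le> 1 - real n * (\<delta>\<^sup>2 / 4)"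
        using Suc by simp
      then obtain c d where c: "\<And>v. v \<in> S \<Longrightarrow> set (c v) \<subseteq> step_colors L \<and> length (c v) = n"
        and d: "\<And>p p'. d p p' \<in> {0..1}" and e: "err c d \<le> 1 - real n * (\<delta>\<^sup>2 / 4)"
        by blast
      have "c \<in> S \<rightarrow> colors \<delta>"
        using c Suc.prems by (auto simp: colors_def L_def N_def)
      then have "\<delta> < quad S w (\<lambda>s t. K s t - d (c s) (c t))"
        using False d unfolding good_def by (meson not_le)
      from regularity_step[OF w K d \<delta> L this]
      obtain l d' where l: "\<And>v. v \<in> S \<Longrightarrow> l v \<in> step_colors L"
        and d': "\<And>p p'. d' p p' \<in> {0..(1::real)}"
        and e': "err (\<lambda>v. l v # c v) d' \<le> err c d - \<delta>\<^sup>2 / 4"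
        unfolding err_def by blast
      have "err (\<lambda>v. l v # c v) d' \<le> 1 - real (Suc n) * (\<delta>\<^sup>2 / 4)"
        using e e' unfolding of_nat_Suc distrib_right by linarith
      then show ?thesis using l d' c
        by (intro disjI2 exI[of _ "\<lambda>v. l v # c v"] exI[of _ d']) auto
    qed auto
  qed
  have "\<exists>c d. good c d"
  proof (rule ccontr)
    assume "\<not> ?thesis"
    then obtain c d where e: "err c d \<le> 1 - real (Suc N) * (\<delta>\<^sup>2 / 4)"
      using step[of "Suc N"] by auto
    have "0 \<le> err c d" unfolding err_def using w by (intro sum_nonneg mult_nonneg_nonneg) auto
    moreover have "1 < real (Suc N) * (\<delta>\<^sup>2 / 4)"
    proof -
      have "4 / \<delta>\<^sup>2 < real (Suc N)" unfolding N_def using real_nat_ceiling_ge[of "4 / \<delta>\<^sup>2"] by linarith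
      then show ?thesis using \<delta> by (simp add: field_simps)
    qed
    ultimately show False using e by linarith
  qed
  then show ?thesis using that unfolding good_def by blast
qed

section \<open>Transfer of cuts between weighted systems\<close>

text \<open>Splitting by the label \<open>i\<close> of \<open>s\<close> turns the cut into
  \<open>q\<close> bilinear forms with 0-1 weights, the indicators of \<open>x s = i\<close> and of
  \<open>i < x t\<close>. By \<open>quad_bound\<close> each is at most \<open>\<kappa>\<close> in
  absolute value.\<close>

lemma abs_qcut_le_quad:
  assumes w: "\<And>v. v \<in> S \<Longrightarrow> 0 \<le> w v" "sum w S = 1"
    and x: "x \<in> S \<rightarrow> {1..q}" and \<kappa>: "quad S w U \<le> \<kappa> ^ 4" "0 \<le> \<kappa>"
  shows "\<bar>qcut S w U x\<bar> \<le> real q * \<kappa>"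
proof -
  have "qcut S w U x = (\<Sum>s\<in>S. \<Sum>t\<in>S. \<Sum>i\<in>{1..q}. w s * w t * (U s t * (of_bool (x s = i) * of_bool (i < x t))))"
    unfolding qcut_def
  proof (intro sum.cong refl)
    fix s t assume "s \<in> S" "t \<in> S"
    then have "(\<Sum>i\<in>{1..q}. w s * w t * (U s t * (of_bool (x s = i) * of_bool (i < x t)))) =
      (\<Sum>i\<in>{1..q}. if x s = i then w s * w t * (U s t * of_bool (i < x t)) else 0)"
      by (intro sum.cong) auto
    moreover have "x s \<in> {1..q}" using x \<open>s \<in> S\<close> by auto
    ultimately show "w s * w t * (U s t * of_bool (x s < x t)) =
      (\<Sum>i\<in>{1..q}. w s * w t * (U s t * (of_bool (x s = i) * of_bool (i < x t))))"
      by (subst (asm) sum.delta') auto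
  qed
  also have "\<dots> = (\<Sum>s\<in>S. \<Sum>i\<in>{1..q}. \<Sum>t\<in>S. w s * w t * (U s t * (of_bool (x s = i) * of_bool (i < x t))))"
    by (intro sum.cong refl sum.swap)
  also have "\<dots> = (\<Sum>i\<in>{1..q}. \<Sum>s\<in>S. \<Sum>t\<in>S. w s * w t * (U s t * (of_bool (x s = i) * of_bool (i < x t))))"
    by (rule sum.swap)
  finally have "\<bar>qcut S w U x\<bar> \<le> (\<Sum>i\<in>{1..q}. \<bar>\<Sum>s\<in>S. \<Sum>t\<in>S. w s * w t * (U s t * (of_bool (x s = i) * of_bool (i < x t)))\<bar>)"
    by simp
  also have "\<dots> \<le> (\<Sum>i\<in>{1..q}. \<kappa>)"
  proof (rule sum_mono)
    fix i
    have "(\<Sum>s\<in>S. \<Sum>t\<in>S. w s * w t * (U s t * (of_bool (x s = i) * of_bool (i < x t)))) ^ 4 \<le> \<kappa> ^ 4"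
      by (rule order_trans[OF quad_bound[OF w] \<kappa>(1)]) auto
    then have "\<bar>\<Sum>s\<in>S. \<Sum>t\<in>S. w s * w t * (U s t * (of_bool (x s = i) * of_bool (i < x t)))\<bar> ^ 4 \<le> \<kappa> ^ 4"
      by (simp add: power_even_abs)
    then show "\<bar>\<Sum>s\<in>S. \<Sum>t\<in>S. w s * w t * (U s t * (of_bool (x s = i) * of_bool (i < x t)))\<bar> \<le> \<kappa>"
      using \<kappa>(2) by (rule power_le_imp_le_base[of _ 3, simplified])
  qed
  finally show ?thesis by simp
qed

lemma qcut_diff: "qcut S w (\<lambda>s t. A s t - B s t) x = qcut S w A x - qcut S w B x"
  unfolding qcut_def by (simp add: algebra_simps sum_subtractf)

text \<open>The contribution of a pair changes only if one of its two ends is relabelled, and then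
  by at most its weight, because \<open>K \<le> 1\<close>.\<close>

lemma qcut_perturb:
  assumes w: "\<And>v. v \<in> S \<Longrightarrow> 0 \<le> w v" "sum w S = 1"
    and K: "\<And>s t. s \<in> S \<Longrightarrow> t \<in> S \<Longrightarrow> K s t \<in> {0..1}"
  shows "qcut S w K y \<le> qcut S w K x + 2 * (\<Sum>v\<in>S. w v * of_bool (x v \<noteq> y v))"
proof -
  let ?b = "\<lambda>v. of_bool (x v \<noteq> y v) :: real"
  have "qcut S w K y \<le> (\<Sum>s\<in>S. \<Sum>t\<in>S. w s * w t * (K s t * of_bool (x s < x t)) +
     ((w s * ?b s) * w t + w s * (w t * ?b t)))"
    unfolding qcut_def
  proof (intro sum_mono)
    fix s t assume st: "s \<in> S" "t \<in> S"
    have "K s t * of_bool (y s < y t) \<le> K s t * of_bool (x s < x t) + (?b s + ?b t)"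
      using K[OF st] by auto
    then have "w s * w t * (K s t * of_bool (y s < y t)) \<le> w s * w t * (K s t * of_bool (x s < x t) + (?b s + ?b t))"
      using w st by (intro mult_left_mono) auto
    then show "w s * w t * (K s t * of_bool (y s < y t)) \<le>
      w s * w t * (K s t * of_bool (x s < x t)) + ((w s * ?b s) * w t + w s * (w t * ?b t))"
      by (simp only: algebra_simps)
  qed
  also have "\<dots> = qcut S w K x + ((\<Sum>v\<in>S. w v * ?b v) * sum w S + sum w S * (\<Sum>v\<in>S. w v * ?b v))"
    unfolding qcut_def sum.distrib sum_product ..
  finally show ?thesis using w(2) by simp
qed

text \<open>For a step function the cut sees a vertex only through its colour and its part. This
  makes cuts on different vertex sets comparable.\<close>

lemma qcut_step:
  assumes "finite C" "c \<in> S \<rightarrow> C" "finite I" "x \<in> S \<rightarrow> I"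
  shows "qcut S w (\<lambda>s t. d (c s) (c t)) x =
    (\<Sum>a\<in>C \<times> I. \<Sum>b\<in>C \<times> I. mass S w (\<lambda>v. (c v, x v)) a * mass S w (\<lambda>v. (c v, x v)) b *
      (d (fst a) (fst b) * of_bool (snd a < snd b)))"
proof -
  have "finite (C \<times> I)" "(\<lambda>v. (c v, x v)) \<in> S \<rightarrow> C \<times> I" using assms by auto
  from sum_pair_by_value[OF this, of w "\<lambda>a b. d (fst a) (fst b) * of_bool (snd a < snd b)"]
  show ?thesis unfolding qcut_def by simp
qed

text \<open>There are \<open>(card C * q)\<^sup>2\<close> pairs of cells; in each, the product of
  two masses in the unit interval changes by at most \<open>2 * \<theta>\<close>, and its
  coefficient is at most 1.\<close>

lemma qcut_step_close:
  fixes C :: "'c set"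
  assumes w: "\<And>v. v \<in> S \<Longrightarrow> 0 \<le> w v" "sum w S = (1::real)"
    and w': "\<And>v. v \<in> S' \<Longrightarrow> 0 \<le> w' v" "sum w' S' = (1::real)"
    and C: "finite C" "c \<in> S \<rightarrow> C" "c' \<in> S' \<rightarrow> C"
    and x: "x \<in> S \<rightarrow> {1..q}" "x' \<in> S' \<rightarrow> {1..q}"
    and d: "\<And>p p'. d p p' \<in> {0..(1::real)}"
    and close: "\<And>p i. p \<in> C \<Longrightarrow> i \<in> {1..q} \<Longrightarrow>
      \<bar>mass S' w' (\<lambda>v. (c' v, x' v)) (p, i) - mass S w (\<lambda>v. (c v, x v)) (p, i)\<bar> \<le> \<theta>"
  shows "qcut S' w' (\<lambda>s t. d (c' s) (c' t)) x' \<le> qcut S w (\<lambda>s t. d (c s) (c t)) x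
     + 2 * (real (card C) * real q)\<^sup>2 * \<theta>"
proof -
  define n where "n = mass S w (\<lambda>v. (c v, x v))"
  define m where "m = mass S' w' (\<lambda>v. (c' v, x' v))"
  define F where "F a b = d (fst a) (fst b) * of_bool (snd a < snd b)" for a b :: "'c \<times> nat"
  let ?A = "C \<times> {1..q}"
  have F: "0 \<le> F a b" "F a b \<le> 1" for a b using d[of "fst a" "fst b"] by (auto simp: F_def)
  have n: "0 \<le> n a" "n a \<le> 1" for a
    using mass_nonneg[of S w] mass_le_sum[of S w] w by (auto simp: n_def)
  have m: "0 \<le> m a" "m a \<le> 1" for a
    using mass_nonneg[of S' w'] mass_le_sum[of S' w'] w' by (auto simp: m_def)
  have "qcut S' w' (\<lambda>s t. d (c' s) (c' t)) x' = (\<Sum>a\<in>?A. \<Sum>b\<in>?A. m a * m b * F a b)"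
    unfolding m_def F_def using C x by (intro qcut_step) auto
  also have "\<dots> \<le> (\<Sum>a\<in>?A. \<Sum>b\<in>?A. n a * n b * F a b + 2 * \<theta>)"
  proof (intro sum_mono)
    fix a b assume ab: "a \<in> ?A" "b \<in> ?A"
    then have "\<bar>m a * m b - n a * n b\<bar> \<le> 2 * \<theta>"
      using close m n by (intro prod_diff_le) (auto simp: m_def n_def)
    then have "\<bar>m a * m b - n a * n b\<bar> * \<bar>F a b\<bar> \<le> (2 * \<theta>) * 1"
      using F[of a b] by (intro mult_mono) auto
    then have "(m a * m b - n a * n b) * F a b \<le> 2 * \<theta>"
      unfolding abs_mult[symmetric] by linarith
    then show "m a * m b * F a b \<le> n a * n b * F a b + 2 * \<theta>" by (simp add: algebra_simps)
  qed
  also have "\<dots> = (\<Sum>a\<in>?A. \<Sum>b\<in>?A. n a * n b * F a b) + 2 * (real (card C) * real q)\<^sup>2 * \<theta>"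
    by (simp add: sum.distrib card_cartesian_product power2_eq_square)
  also have "(\<Sum>a\<in>?A. \<Sum>b\<in>?A. n a * n b * F a b) = qcut S w (\<lambda>s t. d (c s) (c t)) x"
    unfolding n_def F_def using C x by (intro qcut_step[symmetric]) auto
  finally show ?thesis .
qed

lemma mass_pair_sum:
  assumes "finite I" "x \<in> S \<rightarrow> I"
  shows "(\<Sum>i\<in>I. mass S w (\<lambda>v. (c v, x v)) (p, i)) = mass S w c p"
proof -
  have "(\<Sum>i\<in>I. mass S w (\<lambda>v. (c v, x v)) (p, i)) =
      (\<Sum>i\<in>I. mass S (\<lambda>v. w v * of_bool (c v = p)) x i)"
    unfolding mass_def by (intro sum.cong) auto
  also have "\<dots> = (\<Sum>v\<in>S. w v * of_bool (c v = p))" by (rule sum_mass[OF assms])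
  finally show ?thesis by (simp add: mass_def)
qed

lemma mass_pair_sum':
  assumes "finite C" "c \<in> S \<rightarrow> C"
  shows "(\<Sum>p\<in>C. mass S w (\<lambda>v. (c v, x v)) (p, i)) = mass S w x i"
proof -
  have "(\<Sum>p\<in>C. mass S w (\<lambda>v. (c v, x v)) (p, i)) =
      (\<Sum>p\<in>C. mass S (\<lambda>v. w v * of_bool (x v = i)) c p)"
    unfolding mass_def by (intro sum.cong) auto
  also have "\<dots> = (\<Sum>v\<in>S. w v * of_bool (x v = i))" by (rule sum_mass[OF assms])
  finally show ?thesis by (simp add: mass_def)
qed

lemma mass_fiber:
  assumes "finite S"
  shows "mass S w (\<lambda>v. (c v, x v)) (p, i) = mass {v \<in> S. c v = p} w x i"
proof -
  have "mass {v \<in> S. c v = p} w x i = (\<Sum>v\<in>S. if c v = p then w v * of_bool (x v = i) else 0)"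
    unfolding mass_def using assms by (intro sum.inter_filter)
  also have "\<dots> = mass S w (\<lambda>v. (c v, x v)) (p, i)"
    unfolding mass_def by (intro sum.cong) auto
  finally show ?thesis by simp
qed

lemma sum_fiber:
  assumes "finite S"
  shows "sum w {v \<in> S. c v = p} = mass S w c p"
proof -
  have "sum w {v \<in> S. c v = p} = (\<Sum>v\<in>S. if c v = p then w v else 0)"
    using assms by (intro sum.inter_filter)
  also have "\<dots> = mass S w c p" unfolding mass_def by (intro sum.cong) auto
  finally show ?thesis .
qed

text \<open>Each colour class is split on its own. The targets \<open>n p i\<close> are first
  rescaled to the actual mass of the class, which shifts each of them by at most
  \<open>\<gamma>\<close>; \<open>rebalance\<close> then meets the rescaled targets up to one vertex
  weight \<open>\<eta>\<close>.\<close>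

lemma realize_masses:
  fixes I :: "'i set" and c :: "'a \<Rightarrow> 'c"
  assumes S: "finite S" and I: "finite I" "I \<noteq> {}"
    and w: "\<And>v. v \<in> S \<Longrightarrow> 0 < w v \<and> w v \<le> \<eta>" and \<eta>: "0 \<le> \<eta>"
    and c: "c \<in> S \<rightarrow> C" and n: "\<And>p i. 0 \<le> n p i"
    and close: "\<And>p. p \<in> C \<Longrightarrow> \<bar>(\<Sum>i\<in>I. n p i) - mass S w c p\<bar> \<le> \<gamma>"
  shows "\<exists>x\<in>S \<rightarrow> I. \<forall>p\<in>C. \<forall>i\<in>I. \<bar>mass S w (\<lambda>v. (c v, x v)) (p, i) - n p i\<bar> \<le> \<gamma> + \<eta>"
proof -
  obtain i0 where i0: "i0 \<in> I" using I by auto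
  have mn: "0 \<le> mass S w c p" for p using w by (intro mass_nonneg) (auto intro: less_imp_le)
  have "\<exists>x. x \<in> {v \<in> S. c v = p} \<rightarrow> I \<and>
      (\<forall>i\<in>I. \<bar>mass {v \<in> S. c v = p} w x i - n p i\<bar> \<le> \<gamma> + \<eta>)" if p: "p \<in> C" for p
  proof -
    define N where "N = (\<Sum>i\<in>I. n p i)"
    define m where "m = mass S w c p"
    \<comment> \<open>If the targets of the class are all zero, its mass is at most
      \<open>\<gamma>\<close> and can be assigned to an arbitrary part \<open>i0\<close>.\<close>
    define b where "b i = (if N = 0 then m * of_bool (i = i0) else n p i * m / N)" for i
    have N: "0 \<le> N" unfolding N_def using n by (intro sum_nonneg) auto
    have m: "0 \<le> m" using mn by (simp add: m_def)
    have Nm: "\<bar>N - m\<bar> \<le> \<gamma>" using close[OF p] by (simp add: N_def m_def)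
    have nN: "n p i \<le> N" if "i \<in> I" for i
      unfolding N_def using n that I by (intro member_le_sum) auto
    have b0: "0 \<le> b i" for i using n N m by (auto simp: b_def)
    have "sum b I = m"
    proof (cases "N = 0")
      case True
      have "sum b I = (\<Sum>i\<in>I. if i = i0 then m else 0)"
        unfolding b_def using True by (intro sum.cong) auto
      then show ?thesis using i0 I by simp
    next
      case False
      then have "sum b I = (\<Sum>i\<in>I. n p i) * m / N"
        by (simp add: b_def sum_distrib_right sum_divide_distrib)
      then show ?thesis using False by (simp flip: N_def)
    qed
    then have sb: "sum b I = sum w {v \<in> S. c v = p}" unfolding sum_fiber[OF S] m_def .
    have fS: "finite {v \<in> S. c v = p}" using S by simp
    have xS: "(\<lambda>_. i0) \<in> {v \<in> S. c v = p} \<rightarrow> I" using i0 by simp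
    have wS: "\<And>v. v \<in> {v \<in> S. c v = p} \<Longrightarrow> 0 < w v \<and> w v \<le> \<eta>" using w by auto
    obtain x where x: "x \<in> {v \<in> S. c v = p} \<rightarrow> I"
      and xb: "\<And>i. i \<in> I \<Longrightarrow> \<bar>mass {v \<in> S. c v = p} w x i - b i\<bar> \<le> \<eta>"
      using rebalance[OF fS I(1) wS xS b0 sb \<eta>] by blast
    have "\<bar>b i - n p i\<bar> \<le> \<gamma>" if i: "i \<in> I" for i
    proof (cases "N = 0")
      case True
      then have "n p i = 0" using n[of p i] nN[OF i] by simp
      then show ?thesis using True Nm m by (auto simp: b_def)
    next
      case False
      then have "b i - n p i = n p i / N * (m - N)" by (simp add: b_def field_simps)
      moreover have "\<bar>n p i / N\<bar> * \<bar>m - N\<bar> \<le> 1 * \<gamma>"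
        using n[of p i] nN[OF i] N Nm False by (intro mult_mono) (auto simp: divide_le_eq_1)
      ultimately show ?thesis by (simp add: abs_mult)
    qed
    then show ?thesis using x xb by (intro exI[of _ x]) (fastforce simp: abs_le_iff)
  qed
  then have "\<forall>p\<in>C. \<exists>x. x \<in> {v \<in> S. c v = p} \<rightarrow> I \<and>
      (\<forall>i\<in>I. \<bar>mass {v \<in> S. c v = p} w x i - n p i\<bar> \<le> \<gamma> + \<eta>)" by (rule ballI)
  from bchoice[OF this] obtain X where *: "\<forall>p\<in>C. X p \<in> {v \<in> S. c v = p} \<rightarrow> I \<and>
      (\<forall>i\<in>I. \<bar>mass {v \<in> S. c v = p} w (X p) i - n p i\<bar> \<le> \<gamma> + \<eta>)" ..
  have X: "X p \<in> {v \<in> S. c v = p} \<rightarrow> I" if "p \<in> C" for p using *[rule_format, OF that] ..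
  have Xn: "\<bar>mass {v \<in> S. c v = p} w (X p) i - n p i\<bar> \<le> \<gamma> + \<eta>" if "p \<in> C" "i \<in> I" for p i
    using *[THEN bspec, OF that(1), THEN conjunct2] that(2) ..
  show ?thesis
  proof (intro bexI[of _ "\<lambda>v. X (c v) v"] ballI)
    show "(\<lambda>v. X (c v) v) \<in> S \<rightarrow> I" using X c by (auto simp: Pi_iff)
    fix p i assume pi: "p \<in> C" "i \<in> I"
    have "mass {v \<in> S. c v = p} w (\<lambda>v. X (c v) v) i = mass {v \<in> S. c v = p} w (X p) i"
      unfolding mass_def by (intro sum.cong) auto
    then show "\<bar>mass S w (\<lambda>v. (c v, X (c v) v)) (p, i) - n p i\<bar> \<le> \<gamma> + \<eta>"
      unfolding mass_fiber[OF S] using Xn[OF pi] by simp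
  qed
qed

text \<open>The three error terms are the costs of replacing both kernels by the common step
  function, of comparing the cuts of that step function on the two vertex sets, and of restoring
  balance. The last is unavoidable because imitating the cell masses of \<open>x\<close> yields
  parts that are only approximately of size \<open>a i\<close>, whereas \<open>y\<close> must meet
  the tolerance of its own vertex set.\<close>

lemma transfer_cut:
  assumes S': "finite S'"
    and w: "\<And>v. v \<in> S \<Longrightarrow> 0 \<le> w v" "sum w S = (1::real)"
    and w': "\<And>v. v \<in> S' \<Longrightarrow> 0 < w' v \<and> w' v \<le> \<eta>'" "sum w' S' = (1::real)" and \<eta>': "0 \<le> \<eta>'"
    and K': "\<And>s t. s \<in> S' \<Longrightarrow> t \<in> S' \<Longrightarrow> K' s t \<in> {0..1}"
    and C: "finite C" "c \<in> S \<rightarrow> C" "c' \<in> S' \<rightarrow> C"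
    and d: "\<And>p p'. d p p' \<in> {0..(1::real)}"
    and \<kappa>: "quad S w (\<lambda>s t. K s t - d (c s) (c t)) \<le> \<kappa> ^ 4"
      "quad S' w' (\<lambda>s t. K' s t - d (c' s) (c' t)) \<le> \<kappa> ^ 4" "0 \<le> \<kappa>"
    and close: "\<And>p. p \<in> C \<Longrightarrow> \<bar>mass S w c p - mass S' w' c' p\<bar> \<le> \<gamma>"
    and q: "1 \<le> q" and a: "\<And>i. i \<in> {1..q} \<Longrightarrow> 0 \<le> a i" "sum a {1..q} = 1"
    and x: "x \<in> S \<rightarrow> {1..q}" "\<And>i. i \<in> {1..q} \<Longrightarrow> \<bar>mass S w x i - a i\<bar> \<le> \<eta>"
  shows "\<exists>y\<in>S' \<rightarrow> {1..q}. (\<forall>i\<in>{1..q}. \<bar>mass S' w' y i - a i\<bar> \<le> \<eta>') \<and>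
    qcut S' w' K' y \<le> qcut S w K x + 2 * real q * \<kappa> + 2 * (real (card C) * real q)\<^sup>2 * (\<gamma> + \<eta>')
       + 2 * real q * (real (card C) * (\<gamma> + \<eta>') + \<eta>)"
proof -
  define n where "n p i = mass S w (\<lambda>v. (c v, x v)) (p, i)" for p i
  have w'0: "\<And>v. v \<in> S' \<Longrightarrow> 0 \<le> w' v" using w' by (auto intro: less_imp_le)
  have nc: "\<bar>(\<Sum>i\<in>{1..q}. n p i) - mass S' w' c' p\<bar> \<le> \<gamma>" if "p \<in> C" for p
    using close[OF that] unfolding n_def by (subst mass_pair_sum[OF _ x(1)]) auto
  have n0: "0 \<le> n p i" for p i unfolding n_def using w by (intro mass_nonneg)
  have "{1..q} \<noteq> {}" using q by simp
  from realize_masses[OF S' finite_atLeastAtMost this w'(1) \<eta>' C(3) n0 nc]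
  obtain z where z: "z \<in> S' \<rightarrow> {1..q}"
    and zn: "\<And>p i. p \<in> C \<Longrightarrow> i \<in> {1..q} \<Longrightarrow> \<bar>mass S' w' (\<lambda>v. (c' v, z v)) (p, i) - n p i\<bar> \<le> \<gamma> + \<eta>'"
    by blast
  \<comment> \<open>A part collects one cell error per colour, and in addition inherits the
    imbalance of \<open>x\<close>.\<close>
  have za: "\<bar>mass S' w' z i - a i\<bar> \<le> real (card C) * (\<gamma> + \<eta>') + \<eta>" if i: "i \<in> {1..q}" for i
  proof -
    have "mass S' w' z i - mass S w x i = (\<Sum>p\<in>C. mass S' w' (\<lambda>v. (c' v, z v)) (p, i) - n p i)"
      unfolding sum_subtractf n_def mass_pair_sum'[OF C(1,2)] mass_pair_sum'[OF C(1,3)] ..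
    also have "\<bar>\<dots>\<bar> \<le> (\<Sum>p\<in>C. \<gamma> + \<eta>')"
      using zn i by (intro order_trans[OF sum_abs] sum_mono) auto
    finally show ?thesis using x(2)[OF i] by simp
  qed
  have a_sum: "sum a {1..q} = sum w' S'" using a(2) w'(2) by simp
  obtain y where y: "y \<in> S' \<rightarrow> {1..q}" "\<And>i. i \<in> {1..q} \<Longrightarrow> \<bar>mass S' w' y i - a i\<bar> \<le> \<eta>'"
    and D: "(\<Sum>v\<in>S'. w' v * of_bool (z v \<noteq> y v)) \<le> (\<Sum>i\<in>{1..q}. \<bar>mass S' w' z i - a i\<bar>)"
    using rebalance[OF S' finite_atLeastAtMost w'(1) z a(1) a_sum \<eta>'] by blast
  have "(\<Sum>i\<in>{1..q}. \<bar>mass S' w' z i - a i\<bar>) \<le> (\<Sum>i\<in>{1..q}. real (card C) * (\<gamma> + \<eta>') + \<eta>)"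
    using za by (intro sum_mono)
  then have D': "(\<Sum>v\<in>S'. w' v * of_bool (z v \<noteq> y v)) \<le> real q * (real (card C) * (\<gamma> + \<eta>') + \<eta>)"
    using D by simp
  have "qcut S' w' K' y \<le> qcut S' w' K' z + 2 * (\<Sum>v\<in>S'. w' v * of_bool (z v \<noteq> y v))"
    by (rule qcut_perturb[OF w'0 w'(2) K'])
  moreover have "\<bar>qcut S' w' K' z - qcut S' w' (\<lambda>s t. d (c' s) (c' t)) z\<bar> \<le> real q * \<kappa>"
    unfolding qcut_diff[symmetric] by (rule abs_qcut_le_quad[OF w'0 w'(2) z \<kappa>(2,3)])
  moreover have "\<bar>qcut S w K x - qcut S w (\<lambda>s t. d (c s) (c t)) x\<bar> \<le> real q * \<kappa>"
    unfolding qcut_diff[symmetric] by (rule abs_qcut_le_quad[OF w x(1) \<kappa>(1,3)])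
  moreover have "qcut S' w' (\<lambda>s t. d (c' s) (c' t)) z \<le> qcut S w (\<lambda>s t. d (c s) (c t)) x
     + 2 * (real (card C) * real q)\<^sup>2 * (\<gamma> + \<eta>')"
    by (rule qcut_step_close[OF w w'0 w'(2) C x(1) z d zn[unfolded n_def]])
  ultimately have "qcut S' w' K' y \<le> qcut S w K x + 2 * real q * \<kappa> + 2 * (real (card C) * real q)\<^sup>2 * (\<gamma> + \<eta>')
       + 2 * real q * (real (card C) * (\<gamma> + \<eta>') + \<eta>)"
    using D' by linarith
  then show ?thesis using y by blast
qed

section \<open>Four-cycle density of a random sample\<close>

lemma expectation_bind_finite:
  fixes h :: "'b \<Rightarrow> real"
  assumes "finite (set_pmf p)" "\<And>x. x \<in> set_pmf p \<Longrightarrow> finite (set_pmf (f x))"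
  shows "measure_pmf.expectation (bind_pmf p f) h =
    measure_pmf.expectation p (\<lambda>x. measure_pmf.expectation (f x) h)"
  using pmf_expectation_bind[OF assms subset_refl, where h = h]
  by (simp add: integral_measure_pmf_real[OF assms(1)] mult.commute)

lemma expectation_sum_finite:
  fixes f :: "'b \<Rightarrow> 'a \<Rightarrow> real"
  assumes "finite (set_pmf p)"
  shows "measure_pmf.expectation p (\<lambda>y. \<Sum>x\<in>A. f x y) = (\<Sum>x\<in>A. measure_pmf.expectation p (f x))"
  by (intro Bochner_Integration.integral_sum integrable_measure_pmf_finite assms)

lemma expectation_linear_finite:
  fixes f g :: "'a \<Rightarrow> real"
  assumes "finite (set_pmf p)"
  shows "measure_pmf.expectation p (\<lambda>y. a * f y + b * g y) =
    a * measure_pmf.expectation p f + b * measure_pmf.expectation p g"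
  by (subst Bochner_Integration.integral_add) (auto intro: integrable_measure_pmf_finite assms)

lemma expectation_mono_finite:
  fixes f g :: "'a \<Rightarrow> real"
  assumes "finite (set_pmf p)" "\<And>y. y \<in> set_pmf p \<Longrightarrow> f y \<le> g y"
  shows "measure_pmf.expectation p f \<le> measure_pmf.expectation p g"
  using assms by (intro integral_mono_AE integrable_measure_pmf_finite AE_pmfI)

lemma finite_set_Pi_pmf:
  assumes "finite A" "\<And>x. x \<in> A \<Longrightarrow> finite (set_pmf (p x))"
  shows "finite (set_pmf (Pi_pmf A dflt p))"
  using assms by (auto simp: set_Pi_pmf intro!: finite_PiE_dflt)

lemma expectation_prod_Pi_pmf_finite:
  fixes f :: "'a \<Rightarrow> 'b \<Rightarrow> real"
  assumes "finite A" "\<And>x. x \<in> A \<Longrightarrow> finite (set_pmf (p x))"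
  shows "measure_pmf.expectation (Pi_pmf A dflt p) (\<lambda>y. \<Prod>x\<in>A. f x (y x)) =
    (\<Prod>x\<in>A. measure_pmf.expectation (p x) (f x))"
  using assms
proof (induction A rule: finite_induct)
  case (insert a A)
  let ?Q = "Pi_pmf A dflt p"
  have fin: "finite (set_pmf ?Q)" using insert by (intro finite_set_Pi_pmf) auto
  have "Pi_pmf (insert a A) dflt p = bind_pmf (p a) (\<lambda>b. map_pmf (\<lambda>y. y(a := b)) ?Q)"
    using insert.hyps by (simp add: Pi_pmf_insert' map_pmf_def)
  then have "measure_pmf.expectation (Pi_pmf (insert a A) dflt p) (\<lambda>y. \<Prod>x\<in>insert a A. f x (y x)) =
     measure_pmf.expectation (p a) (\<lambda>b. measure_pmf.expectation ?Q (\<lambda>y. \<Prod>x\<in>insert a A. f x ((y(a := b)) x)))"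
    using insert.prems fin by (simp add: expectation_bind_finite del: prod.insert)
  also have "(\<lambda>b. measure_pmf.expectation ?Q (\<lambda>y. \<Prod>x\<in>insert a A. f x ((y(a := b)) x))) =
     (\<lambda>b. f a b * measure_pmf.expectation ?Q (\<lambda>y. \<Prod>x\<in>A. f x (y x)))"
  proof
    fix b
    have "(\<Prod>x\<in>insert a A. f x ((y(a := b)) x)) = f a b * (\<Prod>x\<in>A. f x (y x))" for y
    proof -
      have "(\<Prod>x\<in>A. f x ((y(a := b)) x)) = (\<Prod>x\<in>A. f x (y x))"
        using insert.hyps by (intro prod.cong) auto
      then show ?thesis using insert.hyps by simp
    qed
    then show "measure_pmf.expectation ?Q (\<lambda>y. \<Prod>x\<in>insert a A. f x ((y(a := b)) x)) =
      f a b * measure_pmf.expectation ?Q (\<lambda>y. \<Prod>x\<in>A. f x (y x))" by simp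
  qed
  finally show ?case using insert by simp
qed auto

lemma expectation_prod_Pi_pmf_subset:
  fixes f :: "'a \<Rightarrow> 'b \<Rightarrow> real"
  assumes "finite A" "\<And>x. x \<in> A \<Longrightarrow> finite (set_pmf (p x))" "B \<subseteq> A"
  shows "measure_pmf.expectation (Pi_pmf A dflt p) (\<lambda>y. \<Prod>x\<in>B. f x (y x)) =
    (\<Prod>x\<in>B. measure_pmf.expectation (p x) (f x))"
proof -
  \<comment> \<open>Coordinates outside \<open>B\<close> receive the factor 1, which reduces the
    claim to the product over all of \<open>A\<close>.\<close>
  define g where "g x = (if x \<in> B then f x else (\<lambda>_. 1))" for x
  have "(\<Prod>x\<in>A. g x (y x)) = (\<Prod>x\<in>B. f x (y x))" for y
    using assms by (intro prod.mono_neutral_cong_right) (auto simp: g_def)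
  moreover have "(\<Prod>x\<in>A. measure_pmf.expectation (p x) (g x)) = (\<Prod>x\<in>B. measure_pmf.expectation (p x) (f x))"
    using assms by (intro prod.mono_neutral_cong_right) (auto simp: g_def)
  ultimately show ?thesis
    using expectation_prod_Pi_pmf_finite[OF assms(1,2), where dflt = dflt and f = g] by simp
qed

lemma expectation_prod2_Pi_pmf:
  fixes f g :: "'b \<Rightarrow> real"
  assumes "finite A" "\<And>x. x \<in> A \<Longrightarrow> finite (set_pmf (p x))" "{a, b} \<subseteq> A" "a \<noteq> b"
  shows "measure_pmf.expectation (Pi_pmf A dflt p) (\<lambda>y. f (y a) * g (y b)) =
    measure_pmf.expectation (p a) f * measure_pmf.expectation (p b) g"
  using expectation_prod_Pi_pmf_subset[where p = p and dflt = dflt and f = "\<lambda>x. if x = a then f else g",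
    OF assms(1-3)] assms(4) by simp

lemma expectation_prod4_Pi_pmf:
  fixes f1 f2 f3 f4 :: "'b \<Rightarrow> real"
  assumes "finite A" "\<And>x. x \<in> A \<Longrightarrow> finite (set_pmf (p x))" "set [a1, a2, a3, a4] \<subseteq> A"
    "distinct [a1, a2, a3, a4]"
  shows "measure_pmf.expectation (Pi_pmf A dflt p) (\<lambda>y. f1 (y a1) * f2 (y a2) * f3 (y a3) * f4 (y a4)) =
    measure_pmf.expectation (p a1) f1 * measure_pmf.expectation (p a2) f2 *
    measure_pmf.expectation (p a3) f3 * measure_pmf.expectation (p a4) f4"
proof -
  have "a2 \<noteq> a1" "a3 \<noteq> a1" "a4 \<noteq> a1" "a3 \<noteq> a2" "a4 \<noteq> a2" "a4 \<noteq> a3" using assms(4) by auto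
  then show ?thesis
    using expectation_prod_Pi_pmf_subset[where p = p and dflt = dflt and
      f = "\<lambda>x. if x = a1 then f1 else if x = a2 then f2 else if x = a3 then f3 else f4",
      OF assms(1-3)] assms(4)
    by (simp add: mult.assoc)
qed

text \<open>Independence factorises products only, and \<open>h\<close> is arbitrary. It is
  therefore expanded as a combination of products of point indicators, whose expectations are
  products of point probabilities.\<close>

lemma expectation_4_coordinates:
  fixes h :: "'b \<Rightarrow> 'b \<Rightarrow> 'b \<Rightarrow> 'b \<Rightarrow> real"
  assumes A: "finite A" and V: "finite V" "set_pmf P \<subseteq> V"
    and a: "set [a1, a2, a3, a4] \<subseteq> A" "distinct [a1, a2, a3, a4]"
  shows "measure_pmf.expectation (Pi_pmf A dflt (\<lambda>_. P)) (\<lambda>y. h (y a1) (y a2) (y a3) (y a4)) =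
    (\<Sum>x1\<in>V. \<Sum>x2\<in>V. \<Sum>x3\<in>V. \<Sum>x4\<in>V. pmf P x1 * pmf P x2 * pmf P x3 * pmf P x4 * h x1 x2 x3 x4)"
proof -
  let ?E = "measure_pmf.expectation (Pi_pmf A dflt (\<lambda>_. P))"
  let ?i = "\<lambda>x y. of_bool (y = x) :: real"
  have fP: "finite (set_pmf P)" using V finite_subset by blast
  have fin: "finite (set_pmf (Pi_pmf A dflt (\<lambda>_. P)))" using A fP by (intro finite_set_Pi_pmf)
  have single: "(\<Sum>x\<in>V. ?i x y * f x) = f y" if "y \<in> V" for y and f :: "'b \<Rightarrow> real"
  proof -
    have "(\<Sum>x\<in>V. ?i x y * f x) = (\<Sum>x\<in>V. if y = x then f x else 0)" by (intro sum.cong) auto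
    then show ?thesis using V that by simp
  qed
  have "?E (\<lambda>y. h (y a1) (y a2) (y a3) (y a4)) = ?E (\<lambda>y. \<Sum>x1\<in>V. \<Sum>x2\<in>V. \<Sum>x3\<in>V. \<Sum>x4\<in>V.
      h x1 x2 x3 x4 * (?i x1 (y a1) * ?i x2 (y a2) * ?i x3 (y a3) * ?i x4 (y a4)))"
  proof (rule integral_cong_AE)
    show "AE y in measure_pmf (Pi_pmf A dflt (\<lambda>_. P)). h (y a1) (y a2) (y a3) (y a4) =
      (\<Sum>x1\<in>V. \<Sum>x2\<in>V. \<Sum>x3\<in>V. \<Sum>x4\<in>V.
        h x1 x2 x3 x4 * (?i x1 (y a1) * ?i x2 (y a2) * ?i x3 (y a3) * ?i x4 (y a4)))"
    proof (rule AE_pmfI)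
      fix y assume "y \<in> set_pmf (Pi_pmf A dflt (\<lambda>_. P))"
      then have y: "y a \<in> V" if "a \<in> A" for a using that V(2) A by (auto simp: set_Pi_pmf PiE_dflt_def)
      have "(\<Sum>x1\<in>V. \<Sum>x2\<in>V. \<Sum>x3\<in>V. \<Sum>x4\<in>V.
          h x1 x2 x3 x4 * (?i x1 (y a1) * ?i x2 (y a2) * ?i x3 (y a3) * ?i x4 (y a4))) =
        (\<Sum>x1\<in>V. ?i x1 (y a1) * (\<Sum>x2\<in>V. ?i x2 (y a2) * (\<Sum>x3\<in>V. ?i x3 (y a3) *
          (\<Sum>x4\<in>V. ?i x4 (y a4) * h x1 x2 x3 x4))))"
        unfolding sum_distrib_left by (intro sum.cong refl) (simp only: mult_ac)
      also have "\<dots> = h (y a1) (y a2) (y a3) (y a4)"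
        using y a(1) by (simp only: single set_simps insert_subset)
      finally show "h (y a1) (y a2) (y a3) (y a4) = (\<Sum>x1\<in>V. \<Sum>x2\<in>V. \<Sum>x3\<in>V. \<Sum>x4\<in>V.
        h x1 x2 x3 x4 * (?i x1 (y a1) * ?i x2 (y a2) * ?i x3 (y a3) * ?i x4 (y a4)))" by simp
    qed
  qed auto
  also have "\<dots> = (\<Sum>x1\<in>V. \<Sum>x2\<in>V. \<Sum>x3\<in>V. \<Sum>x4\<in>V.
      h x1 x2 x3 x4 * ?E (\<lambda>y. ?i x1 (y a1) * ?i x2 (y a2) * ?i x3 (y a3) * ?i x4 (y a4)))"
    by (simp only: expectation_sum_finite[OF fin] integral_mult_right_zero)
  also have "\<dots> = (\<Sum>x1\<in>V. \<Sum>x2\<in>V. \<Sum>x3\<in>V. \<Sum>x4\<in>V.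
      h x1 x2 x3 x4 * (pmf P x1 * pmf P x2 * pmf P x3 * pmf P x4))"
  proof (intro sum.cong refl arg_cong2[where f = "(*)"])
    fix x1 x2 x3 x4
    have "measure_pmf.expectation P (?i x) = pmf P x" for x
    proof -
      have "(?i x) = indicator {x}" by (auto simp: indicator_def)
      then show ?thesis by (simp add: pmf.rep_eq)
    qed
    then show "?E (\<lambda>y. ?i x1 (y a1) * ?i x2 (y a2) * ?i x3 (y a3) * ?i x4 (y a4)) =
       pmf P x1 * pmf P x2 * pmf P x3 * pmf P x4"
      by (subst expectation_prod4_Pi_pmf[OF A fP a]) simp
  qed
  finally show ?thesis by (simp add: mult_ac)
qed

section \<open>The sampled graph together with its sampling map\<close>

definition edge_sample :: "nat \<Rightarrow> (nat \<Rightarrow> nat \<Rightarrow> real) \<Rightarrow> (nat \<Rightarrow> nat) \<Rightarrow> (nat \<times> nat \<Rightarrow> bool) pmf" where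
  "edge_sample k K \<Phi> =
     Pi_pmf {(u, v). 1 \<le> u \<and> u < v \<and> v \<le> k} False (\<lambda>(u, v). bernoulli_pmf (K (\<Phi> u) (\<Phi> v)))"

text \<open>The sampling map is kept beside the adjacency data because the colouring of the sample
  is its composition with the colouring of the original graph.\<close>

definition joint_sample :: "nat \<Rightarrow> nat pmf \<Rightarrow> (nat \<Rightarrow> nat \<Rightarrow> real) \<Rightarrow> ((nat \<Rightarrow> nat) \<times> (nat \<times> nat \<Rightarrow> bool)) pmf" where
  "joint_sample k P K = bind_pmf (Pi_pmf {1..k} 0 (\<lambda>_. P)) (\<lambda>\<Phi>. map_pmf (Pair \<Phi>) (edge_sample k K \<Phi>))"

definition adj :: "(nat \<times> nat \<Rightarrow> bool) \<Rightarrow> nat \<Rightarrow> nat \<Rightarrow> real" where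
  "adj X u v = of_bool (X (min u v, max u v))"

lemma finite_pairs: "finite {(u, v). 1 \<le> u \<and> u < v \<and> v \<le> (k::nat)}"
  by (rule finite_subset[of _ "{1..k} \<times> {1..k}"]) auto

lemma finite_set_bernoulli [simp]: "finite (set_pmf (bernoulli_pmf p))"
  by (rule finite_subset[of _ UNIV]) auto

lemma finite_set_edge_sample [simp]: "finite (set_pmf (edge_sample k K \<Phi>))"
  unfolding edge_sample_def by (rule finite_set_Pi_pmf[OF finite_pairs]) (simp split: prod.split)

lemma finite_set_joint_sample:
  assumes "finite (set_pmf P)"
  shows "finite (set_pmf (joint_sample k P K))"
  unfolding joint_sample_def set_bind_pmf using assms
  by (auto intro!: finite_set_Pi_pmf)

lemma expectation_joint_sample:
  fixes h :: "_ \<Rightarrow> real"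
  assumes "finite (set_pmf P)"
  shows "measure_pmf.expectation (joint_sample k P K) h =
    measure_pmf.expectation (Pi_pmf {1..k} 0 (\<lambda>_. P)) (\<lambda>\<Phi>. measure_pmf.expectation (edge_sample k K \<Phi>)
       (\<lambda>X. h (\<Phi>, X)))"
  unfolding joint_sample_def using assms
  by (subst expectation_bind_finite) (auto intro!: finite_set_Pi_pmf)

lemma set_Pi_pmf_range:
  fixes k :: nat
  assumes "set_pmf P \<subseteq> V" "\<Phi> \<in> set_pmf (Pi_pmf {1..k} 0 (\<lambda>_. P))" "u \<in> {1..k}"
  shows "\<Phi> u \<in> V"
  using assms set_Pi_pmf[of "{1..k}" 0 "\<lambda>_. P"] unfolding PiE_dflt_def by auto

lemma expectation_bernoulli_diff:
  assumes "p \<in> {0..1}"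
  shows "measure_pmf.expectation (bernoulli_pmf p) (\<lambda>b. of_bool b - r) = p - r"
  using assms by (simp add: algebra_simps)

text \<open>Four distinct vertices give four distinct unordered pairs, hence independent coin flips,
  and each factor may be replaced by its mean. Symmetry of \<open>K\<close> enters because edges are
  stored with the smaller end first.\<close>

lemma expectation_edge_quad:
  assumes d: "distinct [s, s', t, t']" "set [s, s', t, t'] \<subseteq> {1..k}"
    and V: "\<And>u. u \<in> {1..k} \<Longrightarrow> \<Phi> u \<in> V"
    and K: "\<And>x y. x \<in> V \<Longrightarrow> y \<in> V \<Longrightarrow> K x y \<in> {0..1} \<and> K x y = K y x"
  shows "measure_pmf.expectation (edge_sample k K \<Phi>)
     (\<lambda>X. (adj X s t - r1) * (adj X s t' - r2) * (adj X s' t - r3) * (adj X s' t' - r4)) =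
     (K (\<Phi> s) (\<Phi> t) - r1) * (K (\<Phi> s) (\<Phi> t') - r2) * (K (\<Phi> s') (\<Phi> t) - r3) * (K (\<Phi> s') (\<Phi> t') - r4)"
proof -
  define e where "e u v = (min u v, max u v)" for u v :: nat
  have fac: "measure_pmf.expectation (case e u v of (u, v) \<Rightarrow> bernoulli_pmf (K (\<Phi> u) (\<Phi> v))) (\<lambda>b. of_bool b - r)
     = K (\<Phi> u) (\<Phi> v) - r" if "u \<in> {1..k}" "v \<in> {1..k}" for u v r
  proof -
    have "K (\<Phi> (min u v)) (\<Phi> (max u v)) = K (\<Phi> u) (\<Phi> v)"
      using K[OF V V, OF that] by (auto simp: min_def max_def)
    then show ?thesis
      using expectation_bernoulli_diff[of "K (\<Phi> u) (\<Phi> v)" r] K[OF V V, OF that] by (simp add: e_def)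
  qed
  have dist: "distinct [e s t, e s t', e s' t, e s' t']"
    using d(1) by (auto simp: e_def min_def max_def split: if_splits)
  have sub: "set [e s t, e s t', e s' t, e s' t'] \<subseteq> {(u, v). 1 \<le> u \<and> u < v \<and> v \<le> k}"
    using d by (auto simp: e_def min_def max_def)
  have "measure_pmf.expectation (edge_sample k K \<Phi>)
     (\<lambda>X. (of_bool (X (e s t)) - r1) * (of_bool (X (e s t')) - r2) * (of_bool (X (e s' t)) - r3) * (of_bool (X (e s' t')) - r4)) =
     (K (\<Phi> s) (\<Phi> t) - r1) * (K (\<Phi> s) (\<Phi> t') - r2) * (K (\<Phi> s') (\<Phi> t) - r3) * (K (\<Phi> s') (\<Phi> t') - r4)"
    unfolding edge_sample_def by (subst expectation_prod4_Pi_pmf[OF finite_pairs _ sub dist])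
      (use d(2) in \<open>auto simp: fac split: prod.splits\<close>)
  then show ?thesis by (simp add: adj_def e_def)
qed


text \<open>Tuples of distinct vertices contribute exactly the density of the original kernel error.
  The others contribute at most 1 each, and at most \<open>6 * k ^ 3\<close> of the
  \<open>k ^ 4\<close> tuples contain a coincidence.\<close>

lemma expectation_quad_sample:
  assumes k: "1 \<le> k" and V: "finite V" "set_pmf P \<subseteq> V"
    and K: "\<And>x y. x \<in> V \<Longrightarrow> y \<in> V \<Longrightarrow> K x y \<in> {0..1} \<and> K x y = K y x"
    and D: "\<And>x y. D x y \<in> {0..1}"
  shows "measure_pmf.expectation (joint_sample k P K)
     (\<lambda>(\<Phi>, X). quad {1..k} (\<lambda>_. 1 / real k) (\<lambda>s t. adj X s t - D (\<Phi> s) (\<Phi> t)))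
     \<le> quad V (pmf P) (\<lambda>x y. K x y - D x y) + 6 / real k"
proof -
  let ?E = "measure_pmf.expectation (joint_sample k P K)"
  have fP: "finite (set_pmf P)" using V finite_subset by blast
  note fin = finite_set_joint_sample[OF fP, of k K]
  define Q where "Q = quad V (pmf P) (\<lambda>x y. K x y - D x y)"
  define R where "R \<omega> s t = adj (snd \<omega>) s t - D (fst \<omega> s) (fst \<omega> t)" for \<omega> :: "(nat \<Rightarrow> nat) \<times> (nat \<times> nat \<Rightarrow> bool)" and s t
  have Q0: "0 \<le> Q" unfolding Q_def by (intro quad_nonneg) auto
  have R1: "\<bar>R \<omega> s t\<bar> \<le> 1" for \<omega> s t
    using D[of "fst \<omega> s" "fst \<omega> t"] by (auto simp: R_def adj_def abs_le_iff)
  \<comment> \<open>The number of coinciding pairs among the six: at least 1 for a tuple that is not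
    distinct, and each summand adds up to \<open>k ^ 3\<close>. As \<open>Q\<close> is nonnegative,
    \<open>Q + ?b\<close> bounds every tuple.\<close>
  let ?b = "\<lambda>s s' t t'. of_bool (s = s') + of_bool (s = t) + of_bool (s = t') + of_bool (s' = t) + of_bool (s' = t') + of_bool (t = t') :: real"
  have tuple_le: "?E (\<lambda>\<omega>. R \<omega> s t * R \<omega> s t' * R \<omega> s' t * R \<omega> s' t') \<le> Q + ?b s s' t t'"
    if in_k: "s \<in> {1..k}" "s' \<in> {1..k}" "t \<in> {1..k}" "t' \<in> {1..k}" for s s' t t'
  proof (cases "distinct [s, s', t, t']")
    case True
    have "?E (\<lambda>\<omega>. R \<omega> s t * R \<omega> s t' * R \<omega> s' t * R \<omega> s' t') =
      measure_pmf.expectation (Pi_pmf {1..k} 0 (\<lambda>_. P)) (\<lambda>\<Phi>.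
        (K (\<Phi> s) (\<Phi> t) - D (\<Phi> s) (\<Phi> t)) * (K (\<Phi> s) (\<Phi> t') - D (\<Phi> s) (\<Phi> t')) *
        (K (\<Phi> s') (\<Phi> t) - D (\<Phi> s') (\<Phi> t)) * (K (\<Phi> s') (\<Phi> t') - D (\<Phi> s') (\<Phi> t')))"
      unfolding expectation_joint_sample[OF fP] R_def fst_conv snd_conv
    proof (rule integral_cong_AE)
      show "AE \<Phi> in measure_pmf (Pi_pmf {1..k} 0 (\<lambda>_. P)).
        measure_pmf.expectation (edge_sample k K \<Phi>) (\<lambda>X. (adj X s t - D (\<Phi> s) (\<Phi> t)) * (adj X s t' - D (\<Phi> s) (\<Phi> t')) *
          (adj X s' t - D (\<Phi> s') (\<Phi> t)) * (adj X s' t' - D (\<Phi> s') (\<Phi> t'))) =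
        (K (\<Phi> s) (\<Phi> t) - D (\<Phi> s) (\<Phi> t)) * (K (\<Phi> s) (\<Phi> t') - D (\<Phi> s) (\<Phi> t')) *
        (K (\<Phi> s') (\<Phi> t) - D (\<Phi> s') (\<Phi> t)) * (K (\<Phi> s') (\<Phi> t') - D (\<Phi> s') (\<Phi> t'))"
      proof (rule AE_pmfI)
        fix \<Phi> assume \<Phi>: "\<Phi> \<in> set_pmf (Pi_pmf {1..k} 0 (\<lambda>_. P))"
        show "measure_pmf.expectation (edge_sample k K \<Phi>) (\<lambda>X. (adj X s t - D (\<Phi> s) (\<Phi> t)) * (adj X s t' - D (\<Phi> s) (\<Phi> t')) *
          (adj X s' t - D (\<Phi> s') (\<Phi> t)) * (adj X s' t' - D (\<Phi> s') (\<Phi> t'))) =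
        (K (\<Phi> s) (\<Phi> t) - D (\<Phi> s) (\<Phi> t)) * (K (\<Phi> s) (\<Phi> t') - D (\<Phi> s) (\<Phi> t')) *
        (K (\<Phi> s') (\<Phi> t) - D (\<Phi> s') (\<Phi> t)) * (K (\<Phi> s') (\<Phi> t') - D (\<Phi> s') (\<Phi> t'))"
          using in_k by (intro expectation_edge_quad[OF True _ set_Pi_pmf_range[OF V(2) \<Phi>] K]) auto
      qed
    qed auto
    also have "\<dots> = Q"
      unfolding Q_def quad_def using in_k True
      by (subst expectation_4_coordinates[OF _ V, where ?a1.0 = s and ?a2.0 = s' and ?a3.0 = t and ?a4.0 = t' and
        h = "\<lambda>s s' t t'. (K s t - D s t) * (K s t' - D s t') * (K s' t - D s' t) * (K s' t' - D s' t')"]) auto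
    finally show ?thesis by simp
  next
    case False
    have "?E (\<lambda>\<omega>. R \<omega> s t * R \<omega> s t' * R \<omega> s' t * R \<omega> s' t') \<le> ?E (\<lambda>_. 1)"
    proof (rule expectation_mono_finite[OF fin])
      fix \<omega>
      have "\<bar>R \<omega> s t * R \<omega> s t' * R \<omega> s' t * R \<omega> s' t'\<bar> \<le> 1"
        unfolding abs_mult by (intro mult_le_one R1 mult_nonneg_nonneg abs_ge_zero)
      then show "R \<omega> s t * R \<omega> s t' * R \<omega> s' t * R \<omega> s' t' \<le> 1" by linarith
    qed
    also have "\<dots> = 1" by simp
    also have "1 \<le> ?b s s' t t'" using False by (auto simp: of_bool_def)
    finally show ?thesis using Q0 by simp
  qed
  define c where "c = 1 / real k * (1 / real k) * (1 / real k) * (1 / real k)"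
  have c0: "0 \<le> c" "c * real k ^ 4 = 1" "c * real k ^ 3 = 1 / real k"
    using k by (auto simp: c_def field_simps power_numeral_reduce)
  have "?E (\<lambda>(\<Phi>, X). quad {1..k} (\<lambda>_. 1 / real k) (\<lambda>s t. adj X s t - D (\<Phi> s) (\<Phi> t))) =
    ?E (\<lambda>\<omega>. \<Sum>s\<in>{1..k}. \<Sum>s'\<in>{1..k}. \<Sum>t\<in>{1..k}. \<Sum>t'\<in>{1..k}.
      c * (R \<omega> s t * R \<omega> s t' * R \<omega> s' t * R \<omega> s' t'))"
    unfolding quad_def c_def R_def by (simp add: case_prod_unfold)
  also have "\<dots> = (\<Sum>s\<in>{1..k}. \<Sum>s'\<in>{1..k}. \<Sum>t\<in>{1..k}. \<Sum>t'\<in>{1..k}.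
      c * ?E (\<lambda>\<omega>. R \<omega> s t * R \<omega> s t' * R \<omega> s' t * R \<omega> s' t'))"
    by (simp only: expectation_sum_finite[OF fin] integral_mult_right_zero)
  also have "\<dots> \<le> (\<Sum>s\<in>{1..k}. \<Sum>s'\<in>{1..k}. \<Sum>t\<in>{1..k}. \<Sum>t'\<in>{1..k}. c * (Q + ?b s s' t t'))"
    using tuple_le c0 by (intro sum_mono mult_left_mono) auto
  also have "\<dots> = c * (real k ^ 4 * Q + 6 * real k ^ 3)"
  proof -
    have 1: "(\<Sum>t = Suc 0..k. of_bool (s = t) :: real) = 1" if "Suc 0 \<le> s" "s \<le> k" for s
    proof -
      have "(\<Sum>t = Suc 0..k. of_bool (s = t) :: real) = (\<Sum>t = Suc 0..k. if s = t then 1 else 0)"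
        by (intro sum.cong) auto
      then show ?thesis using that by simp
    qed
    have "(\<Sum>s\<in>{1..k}. \<Sum>s'\<in>{1..k}. \<Sum>t\<in>{1..k}. \<Sum>t'\<in>{1..k}. Q + ?b s s' t t') =
      real k ^ 4 * Q + 6 * real k ^ 3"
    proof -
      have "(\<Sum>s\<in>{1..k}. \<Sum>s'\<in>{1..k}. \<Sum>t\<in>{1..k}. \<Sum>t'\<in>{1..k}. Q + ?b s s' t t') =
        (\<Sum>s\<in>{1..k}. \<Sum>s'\<in>{1..k}. \<Sum>t\<in>{1..k}. real k * (Q + of_bool (s = s') + of_bool (s = t) + of_bool (s' = t)) + 3)"
        by (intro sum.cong refl) (simp add: sum.distrib 1 algebra_simps del: sum_of_bool_eq)
      also have "\<dots> = (\<Sum>s\<in>{1..k}. \<Sum>s'\<in>{1..k}. real k * real k * (Q + of_bool (s = s')) + 2 * real k + 3 * real k)"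
        by (intro sum.cong refl) (simp add: sum.distrib sum_distrib_left[symmetric] 1 algebra_simps del: sum_of_bool_eq)
      also have "\<dots> = (\<Sum>s\<in>{1..k}. real k * real k * real k * Q + real k * real k + 5 * real k * real k)"
        by (intro sum.cong refl) (simp add: sum.distrib sum_distrib_left[symmetric] 1 algebra_simps del: sum_of_bool_eq)
      finally show ?thesis by (simp add: power_numeral_reduce algebra_simps)
    qed
    then show ?thesis by (simp only: sum_distrib_left[symmetric])
  qed
  also have "\<dots> = Q + 6 / real k"
    using c0 by (simp add: distrib_left mult.assoc[symmetric] mult.left_commute[of c 6])
  finally show ?thesis unfolding Q_def .
qed


text \<open>The sampled mass of a colour is a mean of \<open>k\<close> independent indicators.
  Covariances vanish, so its variance is at most \<open>\<mu> / k\<close>; the \<open>\<mu>\<close>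
  sum to 1, and the bound is free of the number of colours.\<close>

lemma expectation_mass_deviation:
  assumes k: "1 \<le> k" and V: "finite V" "set_pmf P \<subseteq> V" and C: "finite C" "c \<in> V \<rightarrow> C"
  shows "measure_pmf.expectation (Pi_pmf {1..k} 0 (\<lambda>_. P)) (\<lambda>\<Phi>. \<Sum>p\<in>C.
     (mass {1..k} (\<lambda>_. 1 / real k) (\<lambda>u. c (\<Phi> u)) p - mass V (pmf P) c p)\<^sup>2) \<le> 1 / real k"
proof -
  let ?E = "measure_pmf.expectation (Pi_pmf {1..k} 0 (\<lambda>_. P))"
  have fP: "finite (set_pmf P)" using V finite_subset by blast
  have fin: "finite (set_pmf (Pi_pmf {1..k} 0 (\<lambda>_. P)))" using fP by (intro finite_set_Pi_pmf) auto
  have single: "?E (\<lambda>\<Phi>. (mass {1..k} (\<lambda>_. 1 / real k) (\<lambda>u. c (\<Phi> u)) p - mass V (pmf P) c p)\<^sup>2)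
      \<le> mass V (pmf P) c p / real k" for p
  proof -
    define \<mu> where "\<mu> = mass V (pmf P) c p"
    define f where "f v = of_bool (c v = p) - \<mu>" for v
    define g where "g = (\<lambda>v. of_bool (c v = p) :: real)"
    have Eg: "measure_pmf.expectation P g = \<mu>"
      using integral_measure_pmf_real[OF V(1), of P g] V(2) by (auto simp: \<mu>_def mass_def g_def mult.commute)
    have "f = (\<lambda>v. 1 * g v + (- \<mu>) * 1)" by (auto simp: f_def g_def)
    then have Ef: "measure_pmf.expectation P f = 0"
      using expectation_linear_finite[OF fP, of 1 g "- \<mu>" "\<lambda>_. 1"] Eg by simp
    have "(\<lambda>v. f v * f v) = (\<lambda>v. (1 - 2 * \<mu>) * g v + \<mu>\<^sup>2 * 1)"
      by (auto simp: f_def g_def power2_eq_square algebra_simps)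
    then have Eff: "measure_pmf.expectation P (\<lambda>v. f v * f v) = \<mu> - \<mu>\<^sup>2"
      using expectation_linear_finite[OF fP, of "1 - 2 * \<mu>" g "\<mu>\<^sup>2" "\<lambda>_. 1"] Eg
      by (simp add: algebra_simps power2_eq_square)
    have two: "?E (\<lambda>\<Phi>. f (\<Phi> u) * f (\<Phi> v)) \<le> \<mu> * of_bool (u = v)"
      if uv: "u \<in> {1..k}" "v \<in> {1..k}" for u v
    proof (cases "u = v")
      case True
      have "?E (\<lambda>\<Phi>. f (\<Phi> u) * f (\<Phi> u)) =
          measure_pmf.expectation (map_pmf (\<lambda>\<Phi>. \<Phi> u) (Pi_pmf {1..k} 0 (\<lambda>_. P))) (\<lambda>v. f v * f v)"
        by simp
      also have "map_pmf (\<lambda>\<Phi>. \<Phi> u) (Pi_pmf {1..k} 0 (\<lambda>_. P)) = P"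
        using uv by (simp add: Pi_pmf_component)
      finally show ?thesis using True Eff by simp
    next
      case False
      then show ?thesis
        using uv fP by (subst expectation_prod2_Pi_pmf) (auto simp: Ef)
    qed
    have "mass {1..k} (\<lambda>_. 1 / real k) (\<lambda>u. c (\<Phi> u)) p - \<mu> = (\<Sum>u\<in>{1..k}. 1 / real k * f (\<Phi> u))" for \<Phi>
      using k by (simp add: mass_def f_def right_diff_distrib sum_subtractf)
    then have "?E (\<lambda>\<Phi>. (mass {1..k} (\<lambda>_. 1 / real k) (\<lambda>u. c (\<Phi> u)) p - \<mu>)\<^sup>2) =
       ?E (\<lambda>\<Phi>. \<Sum>u\<in>{1..k}. \<Sum>v\<in>{1..k}. (1 / real k)\<^sup>2 * (f (\<Phi> u) * f (\<Phi> v)))"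
      by (simp add: power2_eq_square sum_product mult_ac)
    also have "\<dots> = (\<Sum>u\<in>{1..k}. \<Sum>v\<in>{1..k}. (1 / real k)\<^sup>2 * ?E (\<lambda>\<Phi>. f (\<Phi> u) * f (\<Phi> v)))"
      by (simp only: expectation_sum_finite[OF fin] integral_mult_right_zero)
    also have "\<dots> \<le> (\<Sum>u\<in>{1..k}. \<Sum>v\<in>{1..k}. (1 / real k)\<^sup>2 * (\<mu> * of_bool (u = v)))"
      using two by (intro sum_mono mult_left_mono) auto
    also have "\<dots> = (\<Sum>u\<in>{1..k}. \<Sum>v\<in>{1..k}. if u = v then (1 / real k)\<^sup>2 * \<mu> else 0)"
      by (intro sum.cong) auto
    also have "\<dots> = \<mu> / real k" using k by (simp add: power2_eq_square)
    finally show ?thesis by (simp add: \<mu>_def)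
  qed
  have "?E (\<lambda>\<Phi>. \<Sum>p\<in>C. (mass {1..k} (\<lambda>_. 1 / real k) (\<lambda>u. c (\<Phi> u)) p - mass V (pmf P) c p)\<^sup>2)
     \<le> (\<Sum>p\<in>C. mass V (pmf P) c p / real k)"
    unfolding expectation_sum_finite[OF fin] by (intro sum_mono single)
  also have "\<dots> = 1 / real k"
    unfolding sum_divide_distrib[symmetric] sum_mass[OF C] using sum_pmf_eq_1[OF V] by simp
  finally show ?thesis .
qed

text \<open>Both requirements are handled by one application of Markov's inequality, to the
  four-cycle density divided by \<open>\<tau>\<close> plus the sum of squared deviations divided by
  \<open>\<gamma>\<^sup>2\<close>. This quantity is at least 1 whenever either requirement
  fails.\<close>

lemma sample_regularity:
  assumes k: "1 \<le> k" and V: "finite V" "set_pmf P \<subseteq> V"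
    and K: "\<And>x y. x \<in> V \<Longrightarrow> y \<in> V \<Longrightarrow> K x y \<in> {0..1} \<and> K x y = K y x"
    and d: "\<And>p p'. d p p' \<in> {0..1}" and C: "finite C" "c \<in> V \<rightarrow> C"
    and pos: "0 < \<tau>" "0 < \<gamma>"
  shows "measure_pmf.prob (joint_sample k P K) {(\<Phi>, X).
      \<not> (quad {1..k} (\<lambda>_. 1 / real k) (\<lambda>s t. adj X s t - d (c (\<Phi> s)) (c (\<Phi> t))) \<le> \<tau> \<and>
        (\<forall>p\<in>C. \<bar>mass {1..k} (\<lambda>_. 1 / real k) (\<lambda>u. c (\<Phi> u)) p - mass V (pmf P) c p\<bar> \<le> \<gamma>))}
    \<le> (quad V (pmf P) (\<lambda>x y. K x y - d (c x) (c y)) + 6 / real k) / \<tau> + 1 / real k / \<gamma>\<^sup>2"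
    (is "measure_pmf.prob _ ?bad \<le> _")
proof -
  let ?J = "joint_sample k P K"
  let ?E = "measure_pmf.expectation ?J"
  have fP: "finite (set_pmf P)" using V finite_subset by blast
  note fin = finite_set_joint_sample[OF fP, of k K]
  define A where "A = (\<lambda>(\<Phi>, X). quad {1..k} (\<lambda>_. 1 / real k) (\<lambda>s t. adj X s t - d (c (\<Phi> s)) (c (\<Phi> t))))"
  define dev where "dev \<Phi> p = mass {1..k} (\<lambda>_. 1 / real k) (\<lambda>u. c (\<Phi> u)) p - mass V (pmf P) c p"
    for \<Phi> :: "nat \<Rightarrow> nat" and p
  define B where "B = (\<lambda>(\<Phi>, X :: nat \<times> nat \<Rightarrow> bool). \<Sum>p\<in>C. (dev \<Phi> p)\<^sup>2)"
  have A0: "0 \<le> A \<omega>" for \<omega> by (auto simp: A_def intro!: quad_nonneg split: prod.split)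
  have B0: "0 \<le> B \<omega>" for \<omega> by (auto simp: B_def intro!: sum_nonneg split: prod.split)
  have "?bad \<subseteq> {\<omega> \<in> space ?J. 1 \<le> A \<omega> / \<tau> + B \<omega> / \<gamma>\<^sup>2}"
  proof
    fix \<omega> assume "\<omega> \<in> ?bad"
    then obtain \<Phi> X where \<omega>: "\<omega> = (\<Phi>, X)" and "\<tau> < A \<omega> \<or> (\<exists>p\<in>C. \<gamma> < \<bar>dev \<Phi> p\<bar>)"
      unfolding A_def dev_def by force
    then have "1 \<le> A \<omega> / \<tau> \<or> 1 \<le> B \<omega> / \<gamma>\<^sup>2"
    proof (elim disjE bexE)
      fix p assume p: "p \<in> C" "\<gamma> < \<bar>dev \<Phi> p\<bar>"
      have "\<gamma>\<^sup>2 \<le> (dev \<Phi> p)\<^sup>2" using p pos by (intro abs_le_square_iff[THEN iffD1]) auto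
      also have "\<dots> \<le> B \<omega>" unfolding B_def \<omega> using p C by (auto intro!: member_le_sum)
      finally show ?thesis using pos by simp
    qed (use pos in simp)
    moreover have "0 \<le> A \<omega> / \<tau>" "0 \<le> B \<omega> / \<gamma>\<^sup>2" using A0 B0 pos by auto
    ultimately show "\<omega> \<in> {\<omega> \<in> space ?J. 1 \<le> A \<omega> / \<tau> + B \<omega> / \<gamma>\<^sup>2}" by auto
  qed
  then have "measure_pmf.prob ?J ?bad \<le> measure_pmf.prob ?J {\<omega> \<in> space ?J. 1 \<le> A \<omega> / \<tau> + B \<omega> / \<gamma>\<^sup>2}"
    by (intro measure_pmf.finite_measure_mono) auto
  also have "\<dots> \<le> ?E (\<lambda>\<omega>. A \<omega> / \<tau> + B \<omega> / \<gamma>\<^sup>2) / 1"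
    using A0 B0 pos
    by (intro integral_Markov_inequality_measure[where A = "{}"] integrable_measure_pmf_finite[OF fin] AE_I2) auto
  also have "\<dots> = ?E A / \<tau> + ?E B / \<gamma>\<^sup>2"
    using expectation_linear_finite[OF fin, of "1 / \<tau>" A "1 / \<gamma>\<^sup>2" B] by simp
  also have "\<dots> \<le> (quad V (pmf P) (\<lambda>x y. K x y - d (c x) (c y)) + 6 / real k) / \<tau> + 1 / real k / \<gamma>\<^sup>2"
  proof (intro add_mono divide_right_mono)
    show "?E A \<le> quad V (pmf P) (\<lambda>x y. K x y - d (c x) (c y)) + 6 / real k"
      unfolding A_def using d by (intro expectation_quad_sample[OF k V K]) auto
    have "?E B = measure_pmf.expectation (Pi_pmf {1..k} 0 (\<lambda>_. P)) (\<lambda>\<Phi>. \<Sum>p\<in>C. (dev \<Phi> p)\<^sup>2)"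
      unfolding expectation_joint_sample[OF fP] B_def by simp
    then show "?E B \<le> 1 / real k"
      unfolding dev_def using expectation_mass_deviation[OF k V C] by simp
  qed (use pos in auto)
  finally show ?thesis .
qed

section \<open>Balanced cuts of weighted graphs\<close>

definition rel_weight :: "wgraph \<Rightarrow> nat \<Rightarrow> real" where
  "rel_weight G v = vweight G v / total_weight G"

text \<open>A labelling encodes an ordered partition by its fibres; attaining every label means that
  no part is empty. Values outside the vertex set are left free.\<close>

definition assignments :: "nat \<Rightarrow> (nat \<Rightarrow> real) \<Rightarrow> wgraph \<Rightarrow> (nat \<Rightarrow> nat) set" where
  "assignments q a G = {x \<in> verts G \<rightarrow> {1..q}. \<forall>i\<in>{1..q}. i \<in> x ` verts G \<and>
     \<bar>mass (verts G) (rel_weight G) x i - a i\<bar> \<le> max_weight G / total_weight G}"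

definition cut_values :: "nat \<Rightarrow> (nat \<Rightarrow> real) \<Rightarrow> wgraph \<Rightarrow> real set" where
  "cut_values q a G = qcut (verts G) (rel_weight G) (eweight G) ` assignments q a G"

lemma finite_verts [simp]: "finite (verts G)"
  by (simp add: verts_def)

lemma sum_pairs_less:
  fixes F :: "nat \<Rightarrow> nat \<Rightarrow> real"
  shows "(\<Sum>i=1..q-1. \<Sum>j=i+1..q. F i j) = (\<Sum>i\<in>{1..q}. \<Sum>j\<in>{1..q}. F i j * of_bool (i < j))"
proof -
  have "(\<Sum>i=1..q-1. \<Sum>j=i+1..q. F i j) = (\<Sum>i=1..q-1. \<Sum>j\<in>{1..q}. F i j * of_bool (i < j))"
    by (intro sum.cong refl sum.mono_neutral_cong_left) auto
  also have "\<dots> = (\<Sum>i\<in>{1..q}. \<Sum>j\<in>{1..q}. F i j * of_bool (i < j))"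
    by (intro sum.mono_neutral_left) (auto intro!: sum.neutral)
  finally show ?thesis .
qed

lemma qcut_eq_sum_fibers:
  assumes "finite S" "x \<in> S \<rightarrow> {1..q}"
  shows "qcut S w K x = (\<Sum>i=1..q-1. \<Sum>j=i+1..q. \<Sum>s\<in>{s \<in> S. x s = i}. \<Sum>t\<in>{t \<in> S. x t = j}. w s * w t * K s t)"
proof -
  let ?V = "\<lambda>i. {s \<in> S. x s = i}"
  have grp: "(\<Sum>s\<in>S. h s) = (\<Sum>i\<in>{1..q}. \<Sum>s\<in>?V i. h s)" for h :: "'a \<Rightarrow> real"
    using assms by (intro sum.group[symmetric]) auto
  have "qcut S w K x = (\<Sum>i\<in>{1..q}. \<Sum>s\<in>?V i. \<Sum>j\<in>{1..q}. \<Sum>t\<in>?V j. w s * w t * (K s t * of_bool (x s < x t)))"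
    unfolding qcut_def by (subst grp, intro sum.cong refl grp)
  also have "\<dots> = (\<Sum>i\<in>{1..q}. \<Sum>s\<in>?V i. \<Sum>j\<in>{1..q}. \<Sum>t\<in>?V j. w s * w t * K s t * of_bool (i < j))"
    by (intro sum.cong refl) auto
  also have "\<dots> = (\<Sum>i\<in>{1..q}. \<Sum>j\<in>{1..q}. \<Sum>s\<in>?V i. \<Sum>t\<in>?V j. w s * w t * K s t * of_bool (i < j))"
    by (intro sum.cong refl sum.swap)
  also have "\<dots> = (\<Sum>i\<in>{1..q}. \<Sum>j\<in>{1..q}. (\<Sum>s\<in>?V i. \<Sum>t\<in>?V j. w s * w t * K s t) * of_bool (i < j))"
    by (simp only: sum_distrib_right)
  finally show ?thesis unfolding sum_pairs_less .
qed

lemma cut_density_eq_qcut: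
  assumes "x \<in> verts G \<rightarrow> {1..q}" "\<And>i. i \<in> {1..q} \<Longrightarrow> V i = {v \<in> verts G. x v = i}"
  shows "cut_density q G V = qcut (verts G) (rel_weight G) (eweight G) x"
proof -
  have "cut_density q G V = (\<Sum>i=1..q-1. \<Sum>j=i+1..q. 1 / (total_weight G)\<^sup>2 * edges_between G (V i) (V j))"
    unfolding cut_density_def by (simp only: sum_distrib_left)
  also have "\<dots> = (\<Sum>i=1..q-1. \<Sum>j=i+1..q. \<Sum>s\<in>{s \<in> verts G. x s = i}. \<Sum>t\<in>{t \<in> verts G. x t = j}.
      rel_weight G s * rel_weight G t * eweight G s t)"
  proof (intro sum.cong refl)
    fix i j assume "i \<in> {1..q-1}" "j \<in> {i+1..q}"
    then have "V i = {v \<in> verts G. x v = i}" "V j = {v \<in> verts G. x v = j}"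
      by (auto intro!: assms(2))
    then show "1 / (total_weight G)\<^sup>2 * edges_between G (V i) (V j) =
      (\<Sum>s\<in>{s \<in> verts G. x s = i}. \<Sum>t\<in>{t \<in> verts G. x t = j}. rel_weight G s * rel_weight G t * eweight G s t)"
      unfolding edges_between_def
      by (simp add: sum_distrib_left rel_weight_def power2_eq_square)
  qed
  also have "\<dots> = qcut (verts G) (rel_weight G) (eweight G) x"
    by (rule qcut_eq_sum_fibers[OF finite_verts assms(1), symmetric])
  finally show ?thesis .
qed

lemma weight_of_fiber:
  assumes "V = {v \<in> verts G. x v = i}"
  shows "weight_of G V / total_weight G = mass (verts G) (rel_weight G) x i"
proof -
  have "weight_of G V / total_weight G = sum (rel_weight G) {v \<in> verts G. x v = i}"
    unfolding assms weight_of_def rel_weight_def by (rule sum_divide_distrib)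
  then show ?thesis by (simp add: sum_fiber)
qed

text \<open>Covering gives every vertex a label, and disjointness makes the fibres of the labelling
  coincide with the parts. Comparing sets of values avoids choosing between partitions and
  labellings that agree on the vertices.\<close>

lemma cut_density_image:
  "cut_density q G ` balanced_partitions q a G = cut_values q a G"
proof (intro equalityI subsetI)
  fix r assume "r \<in> cut_density q G ` balanced_partitions q a G"
  then obtain V where V: "V \<in> balanced_partitions q a G" and r: "r = cut_density q G V" by blast
  have un: "(\<Union>i\<in>{1..q}. V i) = verts G" and dis: "disjoint_family_on V {1..q}"
    using V by (auto simp: balanced_partitions_def)
  have "\<forall>v\<in>verts G. \<exists>i. i \<in> {1..q} \<and> v \<in> V i" using un by blast
  from bchoice[OF this] obtain x where x: "\<forall>v\<in>verts G. x v \<in> {1..q} \<and> v \<in> V (x v)" ..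
  then have xP: "x \<in> verts G \<rightarrow> {1..q}" by blast
  have fib: "V i = {v \<in> verts G. x v = i}" if i: "i \<in> {1..q}" for i
  proof (intro equalityI subsetI)
    fix v assume v: "v \<in> V i"
    then have vG: "v \<in> verts G" using un i by blast
    then have "x v \<in> {1..q}" "v \<in> V (x v)" using x by auto
    then have "x v = i" using dis i v unfolding disjoint_family_on_def by blast
    then show "v \<in> {v \<in> verts G. x v = i}" using vG by simp
  qed (use x in auto)
  have "x \<in> assignments q a G"
    unfolding assignments_def
  proof (intro CollectI conjI ballI xP)
    fix i assume i: "i \<in> {1..q}"
    have b: "V i \<noteq> {}" "\<bar>weight_of G (V i) / total_weight G - a i\<bar> \<le> max_weight G / total_weight G"
      using V i by (auto simp: balanced_partitions_def)
    show "i \<in> x ` verts G" using b(1) fib[OF i] by auto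
    show "\<bar>mass (verts G) (rel_weight G) x i - a i\<bar> \<le> max_weight G / total_weight G"
      using b(2) unfolding weight_of_fiber[OF fib[OF i]] .
  qed
  moreover have "r = qcut (verts G) (rel_weight G) (eweight G) x"
    unfolding r by (rule cut_density_eq_qcut[OF xP fib])
  ultimately show "r \<in> cut_values q a G" by (simp add: cut_values_def)
next
  fix r assume "r \<in> cut_values q a G"
  then obtain x where x: "x \<in> assignments q a G" and r: "r = qcut (verts G) (rel_weight G) (eweight G) x"
    by (auto simp: cut_values_def)
  then have xP: "x \<in> verts G \<rightarrow> {1..q}" by (simp add: assignments_def)
  define V where "V = restrict (\<lambda>i. {v \<in> verts G. x v = i}) {1..q}"
  have fib: "V i = {v \<in> verts G. x v = i}" if "i \<in> {1..q}" for i
    using that by (simp add: V_def)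
  have "V \<in> balanced_partitions q a G"
    unfolding balanced_partitions_def
  proof (intro CollectI conjI ballI)
    show "V \<in> {1..q} \<rightarrow>\<^sub>E Pow (verts G)" by (auto simp: V_def)
    show "(\<Union>i\<in>{1..q}. V i) = verts G" using xP by (auto simp: fib)
    show "disjoint_family_on V {1..q}" by (auto simp: disjoint_family_on_def fib)
    fix i assume i: "i \<in> {1..q}"
    have "i \<in> x ` verts G" using x i unfolding assignments_def by blast
    then show "V i \<noteq> {}" unfolding fib[OF i] by blast
    show "\<bar>weight_of G (V i) / total_weight G - a i\<bar> \<le> max_weight G / total_weight G"
      using x i unfolding weight_of_fiber[OF fib[OF i]] assignments_def by auto
  qed
  moreover have "r = cut_density q G V"
    unfolding r by (rule cut_density_eq_qcut[OF xP fib, symmetric])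
  ultimately show "r \<in> cut_density q G ` balanced_partitions q a G" by blast
qed

text \<open>Finiteness is taken from partitions, since labellings are unconstrained outside the
  vertices and need not form a finite set.\<close>

lemma finite_cut_values: "finite (cut_values q a G)"
proof -
  have "finite ({1..q} \<rightarrow>\<^sub>E Pow (verts G))" by (intro finite_PiE) auto
  then have "finite (balanced_partitions q a G)"
    by (rule rev_finite_subset) (auto simp: balanced_partitions_def)
  then show ?thesis unfolding cut_density_image[symmetric] by (rule finite_imageI)
qed

lemma min_balanced_cut_density_eq:
  "min_balanced_cut_density q a G = (if cut_values q a G = {} then None else Some (Min (cut_values q a G)))"
  unfolding min_balanced_cut_density_def cut_density_image[symmetric] by simp

section \<open>Invariance under isomorphism\<close>

lemma isomorphic_sym:
  assumes "isomorphic G H"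
  shows "isomorphic H G"
proof -
  obtain \<pi> where \<pi>: "bij_betw \<pi> (verts G) (verts H)" "\<forall>i\<in>verts G. vweight H (\<pi> i) = vweight G i"
    "\<forall>i\<in>verts G. \<forall>j\<in>verts G. eweight H (\<pi> i) (\<pi> j) = eweight G i j"
    using assms unfolding isomorphic_def by blast
  let ?\<rho> = "inv_into (verts G) \<pi>"
  have "bij_betw ?\<rho> (verts H) (verts G)" using \<pi>(1) by (rule bij_betw_inv_into)
  moreover have "?\<rho> v \<in> verts G" "\<pi> (?\<rho> v) = v" if "v \<in> verts H" for v
    using \<pi>(1) that by (auto simp: bij_betw_def inv_into_into f_inv_into_f)
  ultimately show ?thesis
    unfolding isomorphic_def using \<pi> by (intro exI[of _ ?\<rho>]) (metis (no_types, lifting))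
qed

text \<open>Labellings of \<open>H\<close> pull back along the isomorphism without changing part
  masses or cut. The reverse inclusion comes from \<open>isomorphic_sym\<close>.\<close>

lemma cut_values_isomorphic_subset:
  assumes "isomorphic G H"
  shows "cut_values q a H \<subseteq> cut_values q a G"
proof
  fix r assume "r \<in> cut_values q a H"
  then obtain y where y: "y \<in> assignments q a H" and r: "r = qcut (verts H) (rel_weight H) (eweight H) y"
    by (auto simp: cut_values_def)
  obtain \<pi> where \<pi>: "bij_betw \<pi> (verts G) (verts H)"
    and vw: "\<And>i. i \<in> verts G \<Longrightarrow> vweight H (\<pi> i) = vweight G i"
    and ew: "\<And>i j. i \<in> verts G \<Longrightarrow> j \<in> verts G \<Longrightarrow> eweight H (\<pi> i) (\<pi> j) = eweight G i j"
    using assms unfolding isomorphic_def by blast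
  have im: "\<pi> ` verts G = verts H" using \<pi> by (simp add: bij_betw_def)
  have "total_weight H = (\<Sum>v\<in>verts G. vweight H (\<pi> v))"
    unfolding total_weight_def weight_of_def by (rule sum.reindex_bij_betw[OF \<pi>, symmetric])
  then have tot: "total_weight H = total_weight G"
    by (simp add: vw total_weight_def weight_of_def)
  have "vweight H ` verts H = vweight G ` verts G"
    unfolding im[symmetric] image_image by (intro image_cong) (simp_all add: vw)
  then have mx: "max_weight H = max_weight G" by (simp add: max_weight_def)
  have rw: "rel_weight H (\<pi> v) = rel_weight G v" if "v \<in> verts G" for v
    using that by (simp add: rel_weight_def vw tot)
  have ms: "mass (verts H) (rel_weight H) y i = mass (verts G) (rel_weight G) (y \<circ> \<pi>) i" for i
  proof -
    have "mass (verts H) (rel_weight H) y i = (\<Sum>v\<in>verts G. rel_weight H (\<pi> v) * of_bool (y (\<pi> v) = i))"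
      unfolding mass_def by (rule sum.reindex_bij_betw[OF \<pi>, symmetric])
    then show ?thesis by (simp add: mass_def rw)
  qed
  have "r = (\<Sum>s\<in>verts G. \<Sum>t\<in>verts H. rel_weight H (\<pi> s) * rel_weight H t * (eweight H (\<pi> s) t * of_bool (y (\<pi> s) < y t)))"
    unfolding r qcut_def by (rule sum.reindex_bij_betw[OF \<pi>, symmetric])
  also have "\<dots> = (\<Sum>s\<in>verts G. \<Sum>t\<in>verts G. rel_weight H (\<pi> s) * rel_weight H (\<pi> t) * (eweight H (\<pi> s) (\<pi> t) * of_bool (y (\<pi> s) < y (\<pi> t))))"
    by (intro sum.cong refl sum.reindex_bij_betw[OF \<pi>, symmetric])
  also have "\<dots> = qcut (verts G) (rel_weight G) (eweight G) (y \<circ> \<pi>)"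
    unfolding qcut_def by (intro sum.cong refl) (simp add: rw ew)
  finally have "r = qcut (verts G) (rel_weight G) (eweight G) (y \<circ> \<pi>)" .
  moreover have "y \<circ> \<pi> \<in> assignments q a G"
  proof -
    have "y \<in> \<pi> ` verts G \<rightarrow> {1..q}" using y unfolding im by (simp add: assignments_def)
    then have "y \<circ> \<pi> \<in> verts G \<rightarrow> {1..q}" unfolding Pi_iff by simp
    moreover have "(y \<circ> \<pi>) ` verts G = y ` verts H" by (simp only: image_comp[symmetric] im)
    ultimately show ?thesis using y unfolding assignments_def tot mx by (simp add: ms)
  qed
  ultimately show "r \<in> cut_values q a G" by (simp add: cut_values_def)
qed

lemma min_balanced_cut_density_isomorphic:
  assumes "isomorphic G H"
  shows "min_balanced_cut_density q a G = min_balanced_cut_density q a H"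
proof -
  have "cut_values q a G = cut_values q a H"
    using cut_values_isomorphic_subset[OF assms] cut_values_isomorphic_subset[OF isomorphic_sym[OF assms]]
    by (rule equalityI[rotated])
  then show ?thesis by (simp add: min_balanced_cut_density_eq)
qed

section \<open>Existence of balanced partitions and comparison of minima\<close>

lemma total_weight_pos:
  assumes "G \<in> wgraphs"
  shows "0 < total_weight G"
  using assms unfolding total_weight_def weight_of_def
  by (intro sum_pos) (auto simp: wgraphs_def verts_def)

lemma sum_rel_weight:
  assumes "G \<in> wgraphs"
  shows "sum (rel_weight G) (verts G) = 1"
  using total_weight_pos[OF assms]
  by (simp add: rel_weight_def total_weight_def weight_of_def flip: sum_divide_distrib)

lemma rel_weight_bounds:
  assumes "G \<in> wgraphs" "v \<in> verts G"
  shows "0 < rel_weight G v \<and> rel_weight G v \<le> max_weight G / total_weight G"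
  using assms total_weight_pos[OF assms(1)]
  by (auto simp: rel_weight_def max_weight_def wgraphs_def intro!: divide_right_mono)

lemma max_weight_nonneg:
  assumes "G \<in> wgraphs"
  shows "0 \<le> max_weight G / total_weight G"
proof -
  have "1 \<in> verts G" using assms by (auto simp: wgraphs_def verts_def)
  then show ?thesis using rel_weight_bounds[OF assms] by fastforce
qed

text \<open>Nonemptiness is automatic once the tolerance is below \<open>a i\<close>: the mass of
  the part is then positive.\<close>

lemma assignmentsI:
  assumes "x \<in> verts G \<rightarrow> {1..q}"
    and "\<And>i. i \<in> {1..q} \<Longrightarrow> \<bar>mass (verts G) (rel_weight G) x i - a i\<bar> \<le> max_weight G / total_weight G"
    and "\<And>i. i \<in> {1..q} \<Longrightarrow> max_weight G / total_weight G < a i"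
  shows "x \<in> assignments q a G"
  unfolding assignments_def
proof (intro CollectI conjI ballI assms)
  fix i assume i: "i \<in> {1..q}"
  have "mass (verts G) (rel_weight G) x i \<noteq> 0" using assms(2,3)[OF i] by linarith
  then show "i \<in> x ` verts G"
    unfolding mass_def by (force elim!: sum.not_neutral_contains_not_neutral)
qed

lemma cut_values_nonempty:
  assumes G: "G \<in> wgraphs" and q: "1 \<le> q" and a: "sum a {1..q} = 1"
    and small: "\<And>i. i \<in> {1..q} \<Longrightarrow> max_weight G / total_weight G < a i"
  shows "cut_values q a G \<noteq> {}"
proof -
  \<comment> \<open>Any starting labelling can be rebalanced, for instance the one that puts
    everything into part 1.\<close>
  have x: "(\<lambda>_. 1) \<in> verts G \<rightarrow> {1..q}" using q by simp
  have a0: "0 \<le> a i" if "i \<in> {1..q}" for i using small[OF that] max_weight_nonneg[OF G] by linarith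
  have s: "sum a {1..q} = sum (rel_weight G) (verts G)" using a sum_rel_weight[OF G] by simp
  from rebalance[OF finite_verts finite_atLeastAtMost rel_weight_bounds[OF G] x a0 s max_weight_nonneg[OF G]]
  obtain y where y: "y \<in> verts G \<rightarrow> {1..q}"
    "\<And>i. i \<in> {1..q} \<Longrightarrow> \<bar>mass (verts G) (rel_weight G) y i - a i\<bar> \<le> max_weight G / total_weight G"
    by blast
  then have "y \<in> assignments q a G" using small by (rule assignmentsI)
  then show ?thesis unfolding cut_values_def by blast
qed

lemma simple_graph_props:
  assumes "1 \<le> k"
  shows "simple_graph k X \<in> wgraphs" "verts (simple_graph k X) = {1..k}"
    "total_weight (simple_graph k X) = real k" "max_weight (simple_graph k X) = 1"
    "rel_weight (simple_graph k X) = (\<lambda>_. 1 / real k)" "eweight (simple_graph k X) = adj X"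
proof -
  show 1: "verts (simple_graph k X) = {1..k}" by (simp add: simple_graph_def verts_def)
  show 2: "total_weight (simple_graph k X) = real k"
    unfolding total_weight_def weight_of_def 1 by (simp add: simple_graph_def)
  show "max_weight (simple_graph k X) = 1"
    unfolding max_weight_def 1 using assms by (simp add: simple_graph_def image_constant_conv)
  show "rel_weight (simple_graph k X) = (\<lambda>_. 1 / real k)"
    unfolding rel_weight_def 2 by (simp add: simple_graph_def)
  show "eweight (simple_graph k X) = adj X" by (intro ext) (simp add: simple_graph_def adj_def)
  show "simple_graph k X \<in> wgraphs"
    unfolding wgraphs_def using assms by (auto simp: simple_graph_def min.commute max.commute)
qed

lemma sample_eq_joint_sample:
  "sample k G = map_pmf (\<lambda>(\<Phi>, X). simple_graph k X) (joint_sample k (vertex_pmf G) (eweight G))"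
  unfolding sample_def joint_sample_def edge_sample_def by (simp add: map_bind_pmf pmf.map_comp comp_def)


lemma mass_cong: "(\<And>v. v \<in> S \<Longrightarrow> w v = w' v) \<Longrightarrow> mass S w f i = mass S w' f i"
  unfolding mass_def by (intro sum.cong) auto

lemma quad_cong: "(\<And>v. v \<in> S \<Longrightarrow> w v = w' v) \<Longrightarrow> quad S w U = quad S w' U"
  unfolding quad_def by (intro sum.cong refl) simp

lemma Min_cut_values_le:
  assumes "x \<in> assignments q a G"
  shows "Min (cut_values q a G) \<le> qcut (verts G) (rel_weight G) (eweight G) x"
  using assms by (intro Min_le finite_cut_values) (simp add: cut_values_def)

text \<open>A minimiser for \<open>G\<close> is carried over to \<open>H\<close>. Bounding both
  balance tolerances by \<open>\<gamma>\<close> merges the errors of \<open>transfer_cut\<close>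
  other than \<open>2 * q * \<kappa>\<close> into one multiple of \<open>\<gamma>\<close>. The
  one-sided form is used once in each direction.\<close>

lemma min_cut_transfer:
  assumes G: "G \<in> wgraphs" "cut_values q a G \<noteq> {}" and H: "H \<in> wgraphs"
    and q: "1 \<le> q" and a: "sum a {1..q} = 1"
    and small: "\<And>i. i \<in> {1..q} \<Longrightarrow> max_weight H / total_weight H < a i"
      "max_weight G / total_weight G \<le> \<gamma>" "max_weight H / total_weight H \<le> \<gamma>"
    and C: "finite C" "c \<in> verts G \<rightarrow> C" "c' \<in> verts H \<rightarrow> C"
    and d: "\<And>p p'. d p p' \<in> {0..(1::real)}"
    and \<kappa>: "quad (verts G) (rel_weight G) (\<lambda>s t. eweight G s t - d (c s) (c t)) \<le> \<kappa> ^ 4"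
      "quad (verts H) (rel_weight H) (\<lambda>s t. eweight H s t - d (c' s) (c' t)) \<le> \<kappa> ^ 4" "0 \<le> \<kappa>"
    and close: "\<And>p. p \<in> C \<Longrightarrow>
      \<bar>mass (verts G) (rel_weight G) c p - mass (verts H) (rel_weight H) c' p\<bar> \<le> \<gamma>"
  shows "Min (cut_values q a H) \<le> Min (cut_values q a G) + 2 * real q * \<kappa> +
    \<gamma> * (4 * (real (card C) * real q)\<^sup>2 + 4 * real q * real (card C) + 2 * real q)"
proof -
  let ?M = "real (card C)" and ?\<eta>' = "max_weight H / total_weight H"
  have "Min (cut_values q a G) \<in> cut_values q a G" using finite_cut_values G(2) by (rule Min_in)
  then obtain x where x: "x \<in> assignments q a G"
    and xmin: "Min (cut_values q a G) = qcut (verts G) (rel_weight G) (eweight G) x"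
    unfolding cut_values_def by blast
  have xP: "x \<in> verts G \<rightarrow> {1..q}" using x by (simp add: assignments_def)
  have xb: "\<bar>mass (verts G) (rel_weight G) x i - a i\<bar> \<le> \<gamma>" if "i \<in> {1..q}" for i
    using x that small(2) unfolding assignments_def by fastforce
  have w0: "0 \<le> rel_weight G v" if "v \<in> verts G" for v
    using rel_weight_bounds[OF G(1) that] by simp
  have a0: "0 \<le> a i" if "i \<in> {1..q}" for i using small(1)[OF that] max_weight_nonneg[OF H] by linarith
  have K': "eweight H s t \<in> {0..1}" if "s \<in> verts H" "t \<in> verts H" for s t
    using H that by (auto simp: wgraphs_def)
  from transfer_cut[OF finite_verts w0 sum_rel_weight[OF G(1)] rel_weight_bounds[OF H] sum_rel_weight[OF H]
      max_weight_nonneg[OF H] K' C d \<kappa> close q a0 a xP xb]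
  obtain y where y: "y \<in> verts H \<rightarrow> {1..q}"
      "\<And>i. i \<in> {1..q} \<Longrightarrow> \<bar>mass (verts H) (rel_weight H) y i - a i\<bar> \<le> ?\<eta>'"
    and le: "qcut (verts H) (rel_weight H) (eweight H) y \<le> qcut (verts G) (rel_weight G) (eweight G) x
      + 2 * real q * \<kappa> + 2 * (?M * real q)\<^sup>2 * (\<gamma> + ?\<eta>') + 2 * real q * (?M * (\<gamma> + ?\<eta>') + \<gamma>)"
    by blast
  have "y \<in> assignments q a H" using y small(1) by (rule assignmentsI)
  then have "Min (cut_values q a H) \<le> qcut (verts H) (rel_weight H) (eweight H) y"
    by (rule Min_cut_values_le)
  moreover have "2 * (?M * real q)\<^sup>2 * (\<gamma> + ?\<eta>') \<le> 2 * (?M * real q)\<^sup>2 * (\<gamma> + \<gamma>)"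
    using small(3) by (intro mult_left_mono) auto
  moreover have "2 * real q * (?M * (\<gamma> + ?\<eta>') + \<gamma>) \<le> 2 * real q * (?M * (\<gamma> + \<gamma>) + \<gamma>)"
    using small(3) by (intro mult_left_mono add_right_mono) auto
  ultimately show ?thesis using le xmin by (simp add: algebra_simps)
qed

theorem proposition15:
  fixes q :: nat and a :: "nat \<Rightarrow> real"
  assumes "q \<ge> 1"
    and "\<forall>i\<in>{1..q}. a i > 0"
    and "(\<Sum>i=1..q. a i) = 1"
  shows "testable (min_balanced_cut_density q a)"
  unfolding testable_def
proof (intro conjI ballI impI allI)
  fix G H assume "isomorphic G H"
  then show "min_balanced_cut_density q a G = min_balanced_cut_density q a H"
    by (rule min_balanced_cut_density_isomorphic)
next
  fix \<epsilon> :: real assume \<epsilon>: "0 < \<epsilon>"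
  \<comment> \<open>Half of \<open>\<epsilon>\<close> pays for \<open>2 * q * \<kappa>\<close>, the
    replacement of the two kernels; the other half is \<open>\<gamma> * B\<close>.\<close>
  define \<kappa> where "\<kappa> = \<epsilon> / (4 * real q)"
  define \<tau> where "\<tau> = \<kappa> ^ 4"
  \<comment> \<open>The first bound serves the graph itself. The second makes
    \<open>\<delta> / \<tau>\<close>, the contribution of the regularity error to Markov's
    inequality on the sample, at most \<open>\<epsilon> / 2\<close>.\<close>
  define \<delta> where "\<delta> = min \<tau> (\<epsilon> * \<tau> / 2)"
  define C where "C = colors \<delta>"
  \<comment> \<open>The factor of \<open>\<gamma>\<close> in \<open>min_cut_transfer\<close>. It
    involves the number of colours, so \<open>\<gamma>\<close> can only be chosen after
    \<open>\<delta>\<close>.\<close>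
  define B where "B = 4 * (real (card C) * real q)\<^sup>2 + 4 * real q * real (card C) + 2 * real q"
  define \<gamma> where "\<gamma> = \<epsilon> / (2 * B)"
  have q: "0 < real q" using assms(1) by simp
  have \<kappa>: "0 < \<kappa>" using \<epsilon> q by (simp add: \<kappa>_def)
  have \<tau>: "0 < \<tau>" using \<kappa> by (simp add: \<tau>_def)
  have \<delta>: "0 < \<delta>" "\<delta> \<le> \<tau>" "\<delta> \<le> \<epsilon> * \<tau> / 2" using \<tau> \<epsilon> by (auto simp: \<delta>_def)
  have B: "0 < B" using q by (auto simp: B_def intro!: add_nonneg_pos)
  have \<gamma>: "0 < \<gamma>" using \<epsilon> B by (simp add: \<gamma>_def)
  have err: "2 * real q * \<kappa> + \<gamma> * B = \<epsilon>" using q B by (simp add: \<kappa>_def \<gamma>_def)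
  have fC: "finite C" unfolding C_def by (rule finite_colors)
  \<comment> \<open>One summand per demand on \<open>k\<close>: the sampling errors contribute at
    most \<open>\<epsilon> / 2\<close> to the failure probability,
    \<open>1 / k \<le> \<gamma>\<close>, and \<open>1 / k < a i\<close> for every part.\<close>
  define k0 where "k0 = 2 * (6 / \<tau> + 1 / \<gamma>\<^sup>2) / \<epsilon> + 1 / \<gamma> + (\<Sum>i=1..q. 1 / a i)"
  obtain k :: nat where k: "k0 < real k" using reals_Archimedean2 by blast
  have parts: "0 \<le> 2 * (6 / \<tau> + 1 / \<gamma>\<^sup>2) / \<epsilon>" "0 < 1 / \<gamma>" "0 \<le> (\<Sum>i=1..q. 1 / a i)"
    using \<tau> \<gamma> \<epsilon> assms(2) by (auto intro!: sum_nonneg simp: less_imp_le)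
  then have "0 < real k" "1 / \<gamma> < real k" "2 * (6 / \<tau> + 1 / \<gamma>\<^sup>2) / \<epsilon> < real k"
    "(\<Sum>i=1..q. 1 / a i) < real k"
    using k unfolding k0_def by linarith+
  note kk = this
  have k1: "1 \<le> k" using kk(1) by simp
  have k\<gamma>: "1 / real k \<le> \<gamma>" using kk(1,2) \<gamma> by (simp add: field_simps)
  have k\<epsilon>: "6 / real k / \<tau> + 1 / real k / \<gamma>\<^sup>2 \<le> \<epsilon> / 2"
  proof -
    have "6 / real k / \<tau> + 1 / real k / \<gamma>\<^sup>2 = (6 / \<tau> + 1 / \<gamma>\<^sup>2) / real k"
      by (simp add: add_divide_distrib mult.commute)
    also have "\<dots> \<le> \<epsilon> / 2" using kk(1,3) \<epsilon> by (simp add: field_simps)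
    finally show ?thesis .
  qed
  have ka: "1 / real k < a i" if i: "i \<in> {1..q}" for i
  proof -
    have "1 / a i \<le> (\<Sum>i=1..q. 1 / a i)"
      using assms(2) by (intro member_le_sum[OF i]) (auto simp: less_imp_le)
    then have "1 / a i < real k" using kk(4) by linarith
    then show ?thesis using kk(1) assms(2) i by (simp add: field_simps)
  qed
  show "\<exists>k\<ge>1. \<forall>G\<in>wgraphs. max_weight G / total_weight G \<le> 1 / real k \<longrightarrow>
        min_balanced_cut_density q a G \<noteq> None \<and>
        measure_pmf.prob (sample k G) {H. \<epsilon> < \<bar>the (min_balanced_cut_density q a G) -
          the (min_balanced_cut_density q a H)\<bar>} \<le> \<epsilon>"
  proof (intro exI[of _ k] conjI ballI impI k1)
    fix G assume G: "G \<in> wgraphs" and small: "max_weight G / total_weight G \<le> 1 / real k"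
    have smallG: "max_weight G / total_weight G < a i" if "i \<in> {1..q}" for i
      using ka[OF that] small by linarith
    have neG: "cut_values q a G \<noteq> {}" by (rule cut_values_nonempty[OF G assms(1,3) smallG])
    then show "min_balanced_cut_density q a G \<noteq> None" by (simp add: min_balanced_cut_density_eq)
    let ?P = "vertex_pmf G" and ?K = "eweight G" and ?V = "verts G"
    have w: "pmf ?P v = rel_weight G v" if "v \<in> ?V" for v
      using that by (simp add: pmf_vertex_pmf[OF G] rel_weight_def)
    have VP: "set_pmf ?P \<subseteq> ?V" by (auto simp: set_pmf_iff pmf_vertex_pmf[OF G] split: if_splits)
    have K: "?K x y \<in> {0..1} \<and> ?K x y = ?K y x" if "x \<in> ?V" "y \<in> ?V" for x y
      using G that by (auto simp: wgraphs_def)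
    have w0: "0 \<le> rel_weight G v" if "v \<in> ?V" for v using rel_weight_bounds[OF G that] by simp
    obtain c d where c: "c \<in> ?V \<rightarrow> C" and d: "\<And>p p'. d p p' \<in> {0..(1::real)}"
      and reg: "quad ?V (rel_weight G) (\<lambda>s t. ?K s t - d (c s) (c t)) \<le> \<delta>"
      unfolding C_def using weak_regularity[OF w0 sum_rel_weight[OF G] _ \<delta>(1), of ?K] K by blast
    let ?bad = "{(\<Phi>, X).
      \<not> (quad {1..k} (\<lambda>_. 1 / real k) (\<lambda>s t. adj X s t - d (c (\<Phi> s)) (c (\<Phi> t))) \<le> \<tau> \<and>
        (\<forall>p\<in>C. \<bar>mass {1..k} (\<lambda>_. 1 / real k) (\<lambda>u. c (\<Phi> u)) p - mass ?V (pmf ?P) c p\<bar> \<le> \<gamma>))}"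
    let ?J = "joint_sample k ?P ?K"
    let ?far = "{H. \<epsilon> < \<bar>the (min_balanced_cut_density q a G) - the (min_balanced_cut_density q a H)\<bar>}"
    have good: "simple_graph k X \<notin> ?far" if \<omega>: "(\<Phi>, X) \<in> set_pmf ?J" "(\<Phi>, X) \<notin> ?bad" for \<Phi> X
    proof -
      let ?H = "simple_graph k X"
      note H = simple_graph_props[OF k1, of X]
      have "\<Phi> \<in> set_pmf (Pi_pmf {1..k} 0 (\<lambda>_. ?P))"
        using \<omega>(1) by (auto simp: joint_sample_def)
      then have \<Phi>: "\<Phi> u \<in> ?V" if "u \<in> {1..k}" for u
        using set_Pi_pmf_range[OF VP _ that] by blast
      have cH: "(\<lambda>u. c (\<Phi> u)) \<in> verts ?H \<rightarrow> C" using c \<Phi> by (auto simp: H(2))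
      have smallH: "max_weight ?H / total_weight ?H < a i" if "i \<in> {1..q}" for i
        using ka[OF that] by (simp add: H)
      have \<gamma>H: "max_weight ?H / total_weight ?H \<le> \<gamma>" using k\<gamma> by (simp add: H)
      have \<gamma>G: "max_weight G / total_weight G \<le> \<gamma>" using k\<gamma> small by linarith
      have neH: "cut_values q a ?H \<noteq> {}" by (rule cut_values_nonempty[OF H(1) assms(1,3) smallH])
      have quadG: "quad ?V (rel_weight G) (\<lambda>s t. ?K s t - d (c s) (c t)) \<le> \<kappa> ^ 4"
        using reg \<delta>(2) by (simp add: \<tau>_def)
      have quadH: "quad (verts ?H) (rel_weight ?H) (\<lambda>s t. eweight ?H s t - d (c (\<Phi> s)) (c (\<Phi> t))) \<le> \<kappa> ^ 4"
        using \<omega>(2) unfolding H \<tau>_def by simp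
      have close: "\<bar>mass (verts ?H) (rel_weight ?H) (\<lambda>u. c (\<Phi> u)) p - mass ?V (rel_weight G) c p\<bar> \<le> \<gamma>"
        if "p \<in> C" for p
      proof -
        have "mass ?V (rel_weight G) c p = mass ?V (pmf ?P) c p" by (rule mass_cong) (simp add: w)
        then show ?thesis using \<omega>(2) that unfolding H by simp
      qed
      then have close': "\<bar>mass ?V (rel_weight G) c p - mass (verts ?H) (rel_weight ?H) (\<lambda>u. c (\<Phi> u)) p\<bar> \<le> \<gamma>"
        if "p \<in> C" for p using that by (simp add: abs_minus_commute)
      have "Min (cut_values q a ?H) \<le> Min (cut_values q a G) + 2 * real q * \<kappa> + \<gamma> * B"
        unfolding B_def using \<kappa>
        by (intro min_cut_transfer[OF G neG H(1) assms(1,3) smallH \<gamma>G \<gamma>H fC c cH d quadG quadH _ close']) auto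
      moreover have "Min (cut_values q a G) \<le> Min (cut_values q a ?H) + 2 * real q * \<kappa> + \<gamma> * B"
        unfolding B_def using \<kappa>
        by (intro min_cut_transfer[OF H(1) neH G assms(1,3) smallG \<gamma>H \<gamma>G fC cH c d quadH quadG _ close]) auto
      ultimately show ?thesis using err neG neH by (simp add: min_balanced_cut_density_eq)
    qed
    have "measure_pmf.prob (sample k G) ?far =
        measure_pmf.prob ?J ((\<lambda>(\<Phi>, X). simple_graph k X) -` ?far)"
      unfolding sample_eq_joint_sample by simp
    \<comment> \<open>The inclusion holds only almost surely: off the support a sampled vertex may
      lie outside the graph, and its colour then need not lie in \<open>C\<close>.\<close>
    also have "\<dots> \<le> measure_pmf.prob ?J ?bad"
      using good by (intro measure_pmf.finite_measure_mono_AE AE_pmfI) auto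
    also have "\<dots> \<le> (quad ?V (pmf ?P) (\<lambda>x y. ?K x y - d (c x) (c y)) + 6 / real k) / \<tau> + 1 / real k / \<gamma>\<^sup>2"
      by (rule sample_regularity[OF k1 finite_verts VP K d fC c \<tau> \<gamma>])
    also have "quad ?V (pmf ?P) (\<lambda>x y. ?K x y - d (c x) (c y)) = quad ?V (rel_weight G) (\<lambda>x y. ?K x y - d (c x) (c y))"
      by (rule quad_cong[OF w])
    also have "(quad ?V (rel_weight G) (\<lambda>x y. ?K x y - d (c x) (c y)) + 6 / real k) / \<tau> + 1 / real k / \<gamma>\<^sup>2
       \<le> (\<epsilon> * \<tau> / 2 + 6 / real k) / \<tau> + 1 / real k / \<gamma>\<^sup>2"
      using reg \<delta>(3) \<tau> by (intro add_right_mono divide_right_mono) auto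
    also have "\<dots> \<le> \<epsilon>" using k\<epsilon> \<tau> by (simp add: add_divide_distrib)
    finally show "measure_pmf.prob (sample k G) ?far \<le> \<epsilon>" .
  qed
qed

end
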